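(* Let $Q$ be a smooth manifold, $(\Omega,\mathcal{F},P)$ a probability space, $[a,b]\subset\mathbb{R}$, $N\geq 2$, $h=(b-a)/N$ and $t_k=a+hk$. Let $L_d:\mathbb{R}\times\Omega\times Q\times Q\to\mathbb{R}$ be a stochastic discrete Lagrangian, sufficiently smooth in its last two arguments. Assume that almost surely the stochastic discrete Euler-Lagrange equations $$D_3L_d(t_k,\omega,q_k,q_{k+1})+D_4L_d(t_{k-1},\omega,q_{k-1},q_k)=0,\qquad k=1,\dots,N-1,$$ have, for each initial condition $(q_0,q_1)\in Q\times Q$, a unique solution $\{q_k\}_{k=0}^N$, depending smoothly on $(q_0,q_1)$. Let $G$ be a Lie group with Lie algebra $\mathfrak{g}$, acting on $Q$ on the left by $\Phi:G\times Q\to Q$, and suppose that $L_d$ is infinitesimally symmetric with respect to the diagonal action on $Q\times Q$, i.e. for every $\xi\in\mathfrak{g}$, $$\mathbf{d}L_d\cdot\xi_{Q\times Q}=\Theta^+\cdot\xi_{Q\times Q}+\Theta^-\cdot\xi_{Q\times Q}=0 .$$ Then the left and right discrete momentum maps coincide, $J^+=J^-=:J$, and almost surely $J$ is preserved by the discrete flow: every solution of the stochastic discrete Euler-Lagrange equations satisfies $$J(t_{N-1},\omega,q_{N-1},q_N)=J(t_0,\omega,q_0,q_1).$$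
   Context: The stochastic discrete Lagrangian has the form $L_d(t_k,\omega,q_k,q_{k+1})=\mathcal{L}_d(q_k,q_{k+1})+B_d(t_k,q_k,q_{k+1},\omega)$, where $\mathcal{L}_d:Q\times Q\to\mathbb{R}$ is a given discrete Lagrangian and $B_d(t_k,q_k,q_{k+1},\omega)\,h$ is a given random approximation of the sum of Stratonovich integrals $\sum_{i=1}^m\int_{t_k}^{t_{k+1}}\gamma_i(q(t))\circ dW_i$ for given potentials $\gamma_i:Q\to\mathbb{R}$ and independent Wiener processes $W_i$. $D_3L_d$ and $D_4L_d$ denote the differentials of $L_d(t,\omega,\cdot,\cdot)$ in its first and second $Q$-argument; $\mathbf{d}L_d$ is the differential on $Q\times Q$ with $t,\omega$ fixed. The one-forms on $Q\times Q$ (for fixed $t_k,\omega$) are $$\Theta^+(t_k,\omega,q_k,q_{k+1})\cdot(\delta q_k,\delta q_{k+1})=D_4L_d(t_k,\omega,q_k,q_{k+1})\cdot\delta q_{k+1},$$ $$\Theta^-(t_k,\omega,q_k,q_{k+1})\cdot(\delta q_k,\delta q_{k+1})=D_3L_d(t_k,\omega,q_k,q_{k+1})\cdot\delta q_k.$$ The diagonal action is $\Phi_{Q\times Q}(g,q_1,q_2)=(\Phi(g,q_1),\Phi(g,q_2))$, with infinitesimal generator $\xi_{Q\times Q}(q_1,q_2)=\frac{d}{ds}\Phi_{Q\times Q}(\exp(s\xi),q_1,q_2)|_{s=0}$, $\xi\in\mathfrak{g}$. The discrete momentum maps $J^+,J^-$ (with values in $\mathfrak{g}^*$, depending also on $t_k$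 and $\omega$) are defined by $J^+\cdot\xi=\Theta^+\cdot\xi_{Q\times Q}$ and $J^-\cdot\xi=-\Theta^-\cdot\xi_{Q\times Q}$ for all $\xi\in\mathfrak{g}$. *)

theory Defs
  imports "HOL-Analysis.Analysis" "HOL-Probability.Probability" "HOL-Algebra.Group_Action"
    "HOL-Library.Extended_Nat"
begin

section \<open>Maps of class $C^r$ between normed spaces\<close>

text \<open>Meant for open \<open>S\<close>.\<close>

primrec times_differentiable_on ::
  "nat \<Rightarrow> 'a::real_normed_vector set \<Rightarrow> ('a \<Rightarrow> 'b::real_normed_vector) \<Rightarrow> bool" where
  "times_differentiable_on 0 S f \<longleftrightarrow> continuous_on S f"
| "times_differentiable_on (Suc n) S f \<longleftrightarrow>
     (\<forall>x\<in>S. f differentiable (at x)) \<and>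
     (\<forall>v. times_differentiable_on n S (\<lambda>x. frechet_derivative f (at x) v))"

definition Cr_on ::
  "enat \<Rightarrow> 'a::real_normed_vector set \<Rightarrow> ('a \<Rightarrow> 'b::real_normed_vector) \<Rightarrow> bool" where
  "Cr_on r S f \<longleftrightarrow> (\<forall>n. enat n \<le> r \<longrightarrow> times_differentiable_on n S f)"


section \<open>Smooth manifolds\<close>

text \<open>A chart is a pair of a domain and a coordinate map; the coordinate map is only
  relevant on the domain.\<close>

type_synonym ('a, 'e) chart = "'a set \<times> ('a \<Rightarrow> 'e)"

abbreviation dom_of :: "('a, 'e) chart \<Rightarrow> 'a set" where "dom_of \<equiv> fst"
abbreviation coord :: "('a, 'e) chart \<Rightarrow> 'a \<Rightarrow> 'e" where "coord \<equiv> snd"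

definition param :: "('a, 'e) chart \<Rightarrow> 'e \<Rightarrow> 'a" where
  "param c = inv_into (dom_of c) (coord c)"

text \<open>The atlas is an arbitrary smooth atlas; it need not be maximal.\<close>

record ('a, 'e) mfd =
  mfd_top :: "'a topology"
  atlas :: "('a, 'e) chart set"

abbreviation points :: "('a, 'e) mfd \<Rightarrow> 'a set" where
  "points M \<equiv> topspace (mfd_top M)"

definition is_chart :: "'a topology \<Rightarrow> ('a, 'e::euclidean_space) chart \<Rightarrow> bool" where
  "is_chart X c \<longleftrightarrow>
     openin X (dom_of c) \<and> open (coord c ` dom_of c) \<and>
     homeomorphic_map (subtopology X (dom_of c)) (top_of_set (coord c ` dom_of c)) (coord c)"

definition smooth_manifold :: "('a, 'e::euclidean_space) mfd \<Rightarrow> bool" where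
  "smooth_manifold M \<longleftrightarrow>
     Hausdorff_space (mfd_top M) \<and> second_countable (mfd_top M) \<and>
     (\<forall>c\<in>atlas M. is_chart (mfd_top M) c) \<and>
     (\<Union>c\<in>atlas M. dom_of c) = points M \<and>
     (\<forall>c\<in>atlas M. \<forall>d\<in>atlas M.
        Cr_on \<infinity> (coord c ` (dom_of c \<inter> dom_of d)) (coord d \<circ> param c))"

definition prod_mfd :: "('a, 'e) mfd \<Rightarrow> ('b, 'f) mfd \<Rightarrow> ('a \<times> 'b, 'e \<times> 'f) mfd" where
  "prod_mfd M N =
     \<lparr>mfd_top = prod_topology (mfd_top M) (mfd_top N),
      atlas = {(dom_of c \<times> dom_of d, map_prod (coord c) (coord d)) | c d.
                 c \<in> atlas M \<and> d \<in> atlas N}\<rparr>"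

definition euclidean_mfd :: "('e::euclidean_space, 'e) mfd" where
  "euclidean_mfd = \<lparr>mfd_top = euclidean, atlas = {(UNIV, id)}\<rparr>"

definition Cr_map ::
  "enat \<Rightarrow> ('a, 'e::euclidean_space) mfd \<Rightarrow> ('b, 'f::euclidean_space) mfd \<Rightarrow> ('a \<Rightarrow> 'b) \<Rightarrow> bool"
where
  "Cr_map r M N f \<longleftrightarrow>
     continuous_map (mfd_top M) (mfd_top N) f \<and>
     (\<forall>c\<in>atlas M. \<forall>d\<in>atlas N.
        Cr_on r (coord c ` (dom_of c \<inter> f -` dom_of d)) (coord d \<circ> f \<circ> param c))"

abbreviation smooth_map ::
  "('a, 'e::euclidean_space) mfd \<Rightarrow> ('b, 'f::euclidean_space) mfd \<Rightarrow> ('a \<Rightarrow> 'b) \<Rightarrow> bool" where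
  "smooth_map \<equiv> Cr_map \<infinity>"


section \<open>Tangent vectors and differentials\<close>

definition charts_at :: "('a, 'e) mfd \<Rightarrow> 'a \<Rightarrow> ('a, 'e) chart set" where
  "charts_at M q = {c \<in> atlas M. q \<in> dom_of c}"

definition chart_at :: "('a, 'e) mfd \<Rightarrow> 'a \<Rightarrow> ('a, 'e) chart" where
  "chart_at M q = (SOME c. c \<in> charts_at M q)"

text \<open>A tangent vector at \<open>q\<close> is the family of its coordinate representations in the charts
  around \<open>q\<close>, related to each other by the derivatives of the coordinate changes.\<close>

type_synonym ('a, 'e) tvec = "('a, 'e) chart \<Rightarrow> 'e"

definition tangent_space :: "('a, 'e::euclidean_space) mfd \<Rightarrow> 'a \<Rightarrow> ('a, 'e) tvec set" where
  "tangent_space M q =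
     {v. (\<forall>c. c \<notin> charts_at M q \<longrightarrow> v c = 0) \<and>
         (\<forall>c\<in>charts_at M q. \<forall>d\<in>charts_at M q.
            v d = frechet_derivative (coord d \<circ> param c) (at (coord c q)) (v c))}"

definition tscale :: "real \<Rightarrow> ('a, 'e::real_vector) tvec \<Rightarrow> ('a, 'e) tvec" where
  "tscale s v = (\<lambda>c. s *\<^sub>R v c)"

text \<open>In the next two definitions the value on a tangent vector does not depend on the choice
  of the chart around \<open>q\<close>.\<close>

definition tangent_map ::
  "('a, 'e::euclidean_space) mfd \<Rightarrow> ('b, 'f::euclidean_space) mfd \<Rightarrow> ('a \<Rightarrow> 'b) \<Rightarrow> 'a \<Rightarrow>
     ('a, 'e) tvec \<Rightarrow> ('b, 'f) tvec" where
  "tangent_map M N f q v =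
     (let c = chart_at M q in
      (\<lambda>d. if d \<in> charts_at N (f q)
           then frechet_derivative (coord d \<circ> f \<circ> param c) (at (coord c q)) (v c) else 0))"

definition differential ::
  "('a, 'e::euclidean_space) mfd \<Rightarrow> ('a \<Rightarrow> real) \<Rightarrow> 'a \<Rightarrow> ('a, 'e) tvec \<Rightarrow> real" where
  "differential M f q v =
     (let c = chart_at M q in frechet_derivative (f \<circ> param c) (at (coord c q)) (v c))"

definition velocity ::
  "('a, 'e::euclidean_space) mfd \<Rightarrow> (real \<Rightarrow> 'a) \<Rightarrow> real \<Rightarrow> ('a, 'e) tvec" where
  "velocity M \<gamma> s =
     (\<lambda>d. if d \<in> charts_at M (\<gamma> s) then vector_derivative (coord d \<circ> \<gamma>) (at s) else 0)"

definition differentiable_curve :: "('a, 'e::euclidean_space) mfd \<Rightarrow> (real \<Rightarrow> 'a) \<Rightarrow> bool" where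
  "differentiable_curve M \<gamma> \<longleftrightarrow>
     continuous_map euclidean (mfd_top M) \<gamma> \<and>
     (\<forall>s. \<forall>d\<in>charts_at M (\<gamma> s). (coord d \<circ> \<gamma>) differentiable (at s))"

definition integral_curve ::
  "('a, 'e::euclidean_space) mfd \<Rightarrow> ('a \<Rightarrow> ('a, 'e) tvec) \<Rightarrow> (real \<Rightarrow> 'a) \<Rightarrow> bool" where
  "integral_curve M X \<gamma> \<longleftrightarrow>
     differentiable_curve M \<gamma> \<and> (\<forall>s. velocity M \<gamma> s = X (\<gamma> s))"


section \<open>Lie groups and their actions\<close>

definition lie_group :: "'g monoid \<Rightarrow> ('g, 'e::euclidean_space) mfd \<Rightarrow> bool" where
  "lie_group G M \<longleftrightarrow>
     group G \<and> smooth_manifold M \<and> points M = carrier G \<and>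
     smooth_map (prod_mfd M M) M (\<lambda>(g, h). g \<otimes>\<^bsub>G\<^esub> h) \<and>
     smooth_map M M (\<lambda>g. inv\<^bsub>G\<^esub> g)"

definition lie_algebra :: "'g monoid \<Rightarrow> ('g, 'e::euclidean_space) mfd \<Rightarrow> ('g, 'e) tvec set" where
  "lie_algebra G M = tangent_space M \<one>\<^bsub>G\<^esub>"

definition left_invariant_field ::
  "'g monoid \<Rightarrow> ('g, 'e::euclidean_space) mfd \<Rightarrow> ('g, 'e) tvec \<Rightarrow> 'g \<Rightarrow> ('g, 'e) tvec" where
  "left_invariant_field G M \<xi> g = tangent_map M M (\<lambda>h. g \<otimes>\<^bsub>G\<^esub> h) \<one>\<^bsub>G\<^esub> \<xi>"

text \<open>The time-one point of the integral curve through the identity of the left-invariant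
  vector field generated by \<open>\<xi>\<close>.\<close>

definition lie_exp ::
  "'g monoid \<Rightarrow> ('g, 'e::euclidean_space) mfd \<Rightarrow> ('g, 'e) tvec \<Rightarrow> 'g" where
  "lie_exp G M \<xi> =
     (THE \<gamma>. integral_curve M (left_invariant_field G M \<xi>) \<gamma> \<and> \<gamma> 0 = \<one>\<^bsub>G\<^esub>) 1"

definition smooth_left_action ::
  "'g monoid \<Rightarrow> ('g, 'e::euclidean_space) mfd \<Rightarrow> ('q, 'f::euclidean_space) mfd \<Rightarrow>
     ('g \<Rightarrow> 'q \<Rightarrow> 'q) \<Rightarrow> bool" where
  "smooth_left_action G M Q \<Phi> \<longleftrightarrow>
     group_action G (points Q) \<Phi> \<and> smooth_map (prod_mfd M Q) Q (\<lambda>(g, q). \<Phi> g q)"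

definition diagonal_action :: "('g \<Rightarrow> 'q \<Rightarrow> 'q) \<Rightarrow> 'g \<Rightarrow> 'q \<times> 'q \<Rightarrow> 'q \<times> 'q" where
  "diagonal_action \<Phi> g = (\<lambda>(q1, q2). (\<Phi> g q1, \<Phi> g q2))"

definition infinitesimal_generator ::
  "'g monoid \<Rightarrow> ('g, 'e::euclidean_space) mfd \<Rightarrow> ('q, 'f::euclidean_space) mfd \<Rightarrow>
     ('g \<Rightarrow> 'q \<Rightarrow> 'q) \<Rightarrow> ('g, 'e) tvec \<Rightarrow> 'q \<Rightarrow> ('q, 'f) tvec" where
  "infinitesimal_generator G M Q \<Psi> \<xi> q = velocity Q (\<lambda>s. \<Psi> (lie_exp G M (tscale s \<xi>)) q) 0"


section \<open>Stochastic discrete Lagrangians\<close>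

text \<open>The only structural requirement on the noise term \<open>B\<close> is that it is random: being an
  approximation of a Stratonovich integral is a statement about where \<open>B\<close> comes from.\<close>

definition stochastic_discrete_lagrangian ::
  "'w measure \<Rightarrow> ('q, 'e::euclidean_space) mfd \<Rightarrow> ('q \<Rightarrow> 'q \<Rightarrow> real) \<Rightarrow>
     (real \<Rightarrow> 'q \<Rightarrow> 'q \<Rightarrow> 'w \<Rightarrow> real) \<Rightarrow> (real \<Rightarrow> 'w \<Rightarrow> 'q \<Rightarrow> 'q \<Rightarrow> real) \<Rightarrow> bool" where
  "stochastic_discrete_lagrangian P Q Ld B L \<longleftrightarrow>
     (\<forall>t. \<forall>x\<in>points Q. \<forall>y\<in>points Q.
        B t x y \<in> borel_measurable P \<and>
        (\<forall>\<omega>\<in>space P. L t \<omega> x y = Ld x y + B t x y \<omega>))"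

text \<open>In the following, \<open>f\<close> stands for the function \<open>L t \<omega>\<close> on \<open>Q \<times> Q\<close> with \<open>t\<close> and \<open>\<omega>\<close> fixed,
  so that \<open>D_fst\<close> and \<open>D_snd\<close> are the differentials $D_3$ and $D_4$ of \<open>L\<close>.\<close>

definition D_fst ::
  "('q, 'e::euclidean_space) mfd \<Rightarrow> ('q \<Rightarrow> 'q \<Rightarrow> real) \<Rightarrow> 'q \<Rightarrow> 'q \<Rightarrow> ('q, 'e) tvec \<Rightarrow> real" where
  "D_fst Q f x y = differential Q (\<lambda>x'. f x' y) x"

definition D_snd ::
  "('q, 'e::euclidean_space) mfd \<Rightarrow> ('q \<Rightarrow> 'q \<Rightarrow> real) \<Rightarrow> 'q \<Rightarrow> 'q \<Rightarrow> ('q, 'e) tvec \<Rightarrow> real" where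
  "D_snd Q f x y = differential Q (\<lambda>y'. f x y') y"

text \<open>The components of a tangent vector of \<open>Q \<times> Q\<close> are its images under the tangent maps of the
  two projections.\<close>

definition theta_plus ::
  "('q, 'e::euclidean_space) mfd \<Rightarrow> ('q \<Rightarrow> 'q \<Rightarrow> real) \<Rightarrow> 'q \<Rightarrow> 'q \<Rightarrow>
     ('q \<times> 'q, 'e \<times> 'e) tvec \<Rightarrow> real" where
  "theta_plus Q f x y w = D_snd Q f x y (tangent_map (prod_mfd Q Q) Q snd (x, y) w)"

definition theta_minus ::
  "('q, 'e::euclidean_space) mfd \<Rightarrow> ('q \<Rightarrow> 'q \<Rightarrow> real) \<Rightarrow> 'q \<Rightarrow> 'q \<Rightarrow>
     ('q \<times> 'q, 'e \<times> 'e) tvec \<Rightarrow> real" where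
  "theta_minus Q f x y w = D_fst Q f x y (tangent_map (prod_mfd Q Q) Q fst (x, y) w)"

definition diagonal_generator ::
  "'g monoid \<Rightarrow> ('g, 'd::euclidean_space) mfd \<Rightarrow> ('q, 'e::euclidean_space) mfd \<Rightarrow>
     ('g \<Rightarrow> 'q \<Rightarrow> 'q) \<Rightarrow> ('g, 'd) tvec \<Rightarrow> 'q \<Rightarrow> 'q \<Rightarrow> ('q \<times> 'q, 'e \<times> 'e) tvec" where
  "diagonal_generator G M Q \<Phi> \<xi> x y =
     infinitesimal_generator G M (prod_mfd Q Q) (diagonal_action \<Phi>) \<xi> (x, y)"

definition momentum_plus ::
  "'g monoid \<Rightarrow> ('g, 'd::euclidean_space) mfd \<Rightarrow> ('q, 'e::euclidean_space) mfd \<Rightarrow>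
     ('g \<Rightarrow> 'q \<Rightarrow> 'q) \<Rightarrow> ('q \<Rightarrow> 'q \<Rightarrow> real) \<Rightarrow> 'q \<Rightarrow> 'q \<Rightarrow> ('g, 'd) tvec \<Rightarrow> real" where
  "momentum_plus G M Q \<Phi> f x y =
     (\<lambda>\<xi>\<in>lie_algebra G M. theta_plus Q f x y (diagonal_generator G M Q \<Phi> \<xi> x y))"

definition momentum_minus ::
  "'g monoid \<Rightarrow> ('g, 'd::euclidean_space) mfd \<Rightarrow> ('q, 'e::euclidean_space) mfd \<Rightarrow>
     ('g \<Rightarrow> 'q \<Rightarrow> 'q) \<Rightarrow> ('q \<Rightarrow> 'q \<Rightarrow> real) \<Rightarrow> 'q \<Rightarrow> 'q \<Rightarrow> ('g, 'd) tvec \<Rightarrow> real" where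
  "momentum_minus G M Q \<Phi> f x y =
     (\<lambda>\<xi>\<in>lie_algebra G M. - theta_minus Q f x y (diagonal_generator G M Q \<Phi> \<xi> x y))"

definition infinitesimally_symmetric ::
  "'g monoid \<Rightarrow> ('g, 'd::euclidean_space) mfd \<Rightarrow> ('q, 'e::euclidean_space) mfd \<Rightarrow>
     ('g \<Rightarrow> 'q \<Rightarrow> 'q) \<Rightarrow> ('q \<Rightarrow> 'q \<Rightarrow> real) \<Rightarrow> bool" where
  "infinitesimally_symmetric G M Q \<Phi> f \<longleftrightarrow>
     (\<forall>\<xi>\<in>lie_algebra G M. \<forall>x\<in>points Q. \<forall>y\<in>points Q.
        differential (prod_mfd Q Q) (\<lambda>(x', y'). f x' y') (x, y)
          (diagonal_generator G M Q \<Phi> \<xi> x y) = 0)"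

text \<open>Here \<open>F k\<close> stands for \<open>L (t k) \<omega>\<close>. The equation is an equality of covectors at \<open>q k\<close>.\<close>

definition discrete_EL_solution ::
  "('q, 'e::euclidean_space) mfd \<Rightarrow> nat \<Rightarrow> (nat \<Rightarrow> 'q \<Rightarrow> 'q \<Rightarrow> real) \<Rightarrow> (nat \<Rightarrow> 'q) \<Rightarrow> bool" where
  "discrete_EL_solution Q N F q \<longleftrightarrow>
     (\<forall>k\<le>N. q k \<in> points Q) \<and>
     (\<forall>k\<in>{1..N - 1}. \<forall>v\<in>tangent_space Q (q k).
        D_fst Q (F k) (q k) (q (k + 1)) v + D_snd Q (F (k - 1)) (q (k - 1)) (q k) v = 0)"

definition uniquely_solvable ::
  "enat \<Rightarrow> ('q, 'e::euclidean_space) mfd \<Rightarrow> nat \<Rightarrow> (nat \<Rightarrow> 'q \<Rightarrow> 'q \<Rightarrow> real) \<Rightarrow> bool" where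
  "uniquely_solvable s Q N F \<longleftrightarrow>
     (\<exists>flow :: 'q \<times> 'q \<Rightarrow> nat \<Rightarrow> 'q.
        (\<forall>x\<in>points Q. \<forall>y\<in>points Q.
           discrete_EL_solution Q N F (flow (x, y)) \<and> flow (x, y) 0 = x \<and> flow (x, y) 1 = y \<and>
           (\<forall>q. discrete_EL_solution Q N F q \<and> q 0 = x \<and> q 1 = y \<longrightarrow>
                (\<forall>k\<le>N. q k = flow (x, y) k))) \<and>
        (\<forall>k\<le>N. Cr_map s (prod_mfd Q Q) Q (\<lambda>z. flow z k)))"

end

theory Submission
  imports Defs
begin

text \<open>On $Q \times Q$ one has $\mathbf{d}L_d = \Theta^+ + \Theta^-$, so infinitesimal symmetry says
  $J^+ = J^-$. The Euler-Lagrange equation at $q_k$, applied to the tangent vector $\xi_Q(q_k)$,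
  says that $J^-$ at $(q_k, q_{k+1})$ equals $J^+$ at $(q_{k-1}, q_k)$, because the two components
  of $\xi_{Q \times Q}$ are values of $\xi_Q$. The analytic content is that $\xi_Q(q)$ is the
  velocity of a differentiable curve at all: left-invariant vector fields on a Lie group have
  unique global integral curves, so $s \mapsto \exp(s\xi)$ is differentiable.\<close>


section \<open>Autonomous differential equations\<close>

lemma times_differentiable_on_1_imp_local_lipschitz:
  fixes f :: "'a::euclidean_space \<Rightarrow> 'a"
  assumes f: "times_differentiable_on (Suc 0) S f" and "open S"
  shows "local_lipschitz (UNIV :: real set) S (\<lambda>_. f)"
proof (rule c1_implies_local_lipschitz)
  let ?D = "\<lambda>(t::real, x). Blinfun (frechet_derivative f (at x))"
  have f_deriv: "(f has_derivative frechet_derivative f (at x)) (at x)" if "x \<in> S" for x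
    using f that by (simp add: frechet_derivative_works)
  then have D_apply: "blinfun_apply (?D (t, x)) = frechet_derivative f (at x)" if "x \<in> S" for t x
    using that bounded_linear_Blinfun_apply has_derivative_bounded_linear by fastforce
  with f_deriv show "(f has_derivative blinfun_apply (?D (t, x))) (at x)" if "x \<in> S" for t x
    using that by simp
  show "continuous_on (UNIV \<times> S) ?D"
  proof (rule continuous_on_blinfun_componentwise)
    fix b :: 'a
    have "continuous_on S (\<lambda>x. frechet_derivative f (at x) b)"
      using f by simp
    then have "continuous_on ((UNIV :: real set) \<times> S) (\<lambda>z. frechet_derivative f (at (snd z)) b)"
      by (rule continuous_on_compose2) (auto intro!: continuous_intros)
    then show "continuous_on (UNIV \<times> S) (\<lambda>z. blinfun_apply (?D z) b)"
      by (rule continuous_on_eq) (use D_apply in auto)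
  qed
qed (use \<open>open S\<close> in auto)

lemma times_differentiable_on_1_Pair_const:
  fixes f :: "'a::real_normed_vector \<times> 'b::real_normed_vector \<Rightarrow> 'c::real_normed_vector"
  assumes f: "times_differentiable_on (Suc 0) S f"
  shows "times_differentiable_on (Suc 0) {x. (x, y) \<in> S} (\<lambda>x. f (x, y))"
proof -
  let ?D = "\<lambda>z. frechet_derivative f (at z)"
  have f_deriv: "((\<lambda>x. f (x, y)) has_derivative (\<lambda>v. ?D (x, y) (v, 0))) (at x)"
    if "(x, y) \<in> S" for x
  proof -
    have "((\<lambda>x. (x, y)) has_derivative (\<lambda>v. (v, 0))) (at x)"
      by (auto intro!: derivative_eq_intros)
    moreover have "(f has_derivative ?D (x, y)) (at (x, y))"
      using f that by (simp add: frechet_derivative_works)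
    ultimately show ?thesis
      by (rule has_derivative_compose)
  qed
  have "continuous_on {x. (x, y) \<in> S} (\<lambda>x. frechet_derivative (\<lambda>x. f (x, y)) (at x) v)" for v
  proof (rule continuous_on_eq)
    have "continuous_on S (\<lambda>z. ?D z (v, 0))"
      using f by simp
    then show "continuous_on {x. (x, y) \<in> S} (\<lambda>x. ?D (x, y) (v, 0))"
      by (rule continuous_on_compose2) (auto intro!: continuous_intros)
    show "?D (x, y) (v, 0) = frechet_derivative (\<lambda>x. f (x, y)) (at x) v"
      if "x \<in> {x. (x, y) \<in> S}" for x
      using frechet_derivative_at[OF f_deriv, of x] that by (simp add: fun_eq_iff)
  qed
  then show ?thesis
    using f_deriv by (auto intro: differentiableI)
qed

lemma local_lipschitz_cballE:
  assumes "local_lipschitz T S (\<lambda>_. f)" "t \<in> T" "open S" "x \<in> S"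
  obtains r L where "r > 0" "cball x r \<subseteq> S" "L-lipschitz_on (cball x r) f"
proof -
  obtain u L where "u > 0" and L: "\<And>s. s \<in> cball t u \<inter> T \<Longrightarrow> L-lipschitz_on (cball x u \<inter> S) f"
    using assms local_lipschitzE by blast
  obtain e where "e > 0" "cball x e \<subseteq> S"
    using assms open_contains_cball by blast
  show ?thesis
  proof
    show "min u e > 0" "cball x (min u e) \<subseteq> S"
      using \<open>u > 0\<close> \<open>e > 0\<close> \<open>cball x e \<subseteq> S\<close> by auto
    show "L-lipschitz_on (cball x (min u e)) f"
      by (rule lipschitz_on_subset[OF L[of t]])
        (use \<open>t \<in> T\<close> \<open>u > 0\<close> \<open>cball x e \<subseteq> S\<close> in auto)
  qed
qed

lemma local_lipschitz_transform:
  assumes "local_lipschitz T X f" and "\<And>t x. t \<in> T \<Longrightarrow> x \<in> X \<Longrightarrow> f t x = g t x"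
  shows "local_lipschitz T X g"
  using assms unfolding local_lipschitz_def lipschitz_on_def by simp

lemma vector_derivative_bound:
  fixes x :: "real \<Rightarrow> 'a::real_normed_vector"
  assumes x: "\<And>s. s \<in> S \<Longrightarrow> (x has_vector_derivative x' s) (at s within S)"
    and bound: "\<And>s. s \<in> S \<Longrightarrow> norm (x' s) \<le> C"
    and "convex S" "s \<in> S" "t \<in> S"
  shows "norm (x s - x t) \<le> C * \<bar>s - t\<bar>"
proof -
  have "norm (x s - x t) \<le> C * norm (s - t)"
  proof (rule differentiable_bound[OF \<open>convex S\<close>])
    show "(x has_derivative (\<lambda>h. h *\<^sub>R x' s)) (at s within S)" if "s \<in> S" for s
      using x[OF that] by (simp add: has_vector_derivative_def)
    show "onorm (\<lambda>h. h *\<^sub>R x' s) \<le> C" if "s \<in> S" for s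
      using bound[OF that] by (intro onorm_le) (simp add: mult.commute[of "\<bar>_\<bar>"] mult_right_mono)
  qed fact+
  then show ?thesis by simp
qed

definition picard_map ::
  "('a::euclidean_space \<Rightarrow> 'a) \<Rightarrow> real \<Rightarrow> 'a \<Rightarrow> (real \<Rightarrow> 'a) \<Rightarrow> real \<Rightarrow> 'a" where
  "picard_map F t0 u0 x s = u0 + (LBINT \<tau>=t0..s. F (x \<tau>))"

lemma picard_map_initial: "picard_map F t0 u0 x t0 = u0"
  by (simp add: picard_map_def)

lemma picard_map_has_vector_derivative:
  assumes "continuous_on UNIV F" "continuous_on {a..b} x" "t0 \<in> {a..b}" "s \<in> {a..b}"
  shows "(picard_map F t0 u0 x has_vector_derivative F (x s)) (at s within {a..b})"
proof -
  have "continuous_on {a..b} (\<lambda>\<tau>. F (x \<tau>))"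
    using assms(1,2) by (rule continuous_on_compose2) auto
  then have "((\<lambda>s. LBINT \<tau>=t0..s. F (x \<tau>)) has_vector_derivative F (x s)) (at s within {a..b})"
    using assms(3,4) by (intro interval_integral_FTC2) auto
  from has_vector_derivative_add[OF has_vector_derivative_const this] show ?thesis
    by (simp add: picard_map_def[abs_def])
qed

lemma dist_picard_map_le:
  fixes x y :: "real \<Rightarrow>\<^sub>C 'a::euclidean_space"
  assumes F: "L-lipschitz_on UNIV F" and t0: "t0 \<in> {a..b}" and s: "s \<in> {a..b}"
  shows "dist (picard_map F t0 u0 x s) (picard_map F t0 u0 y s) \<le> (b - a) * L * dist x y"
proof -
  let ?P = "picard_map F t0 u0"
  note picard_deriv = picard_map_has_vector_derivative[OF lipschitz_on_continuous_on[OF F]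
      continuous_on_apply_bcontfun t0]
  have dist_F: "norm (F (x \<tau>) - F (y \<tau>)) \<le> L * dist x y" for \<tau>
  proof -
    have "norm (F (x \<tau>) - F (y \<tau>)) \<le> L * dist (x \<tau>) (y \<tau>)"
      using lipschitz_onD[OF F] by (simp add: dist_norm)
    also have "\<dots> \<le> L * dist x y"
      by (intro mult_left_mono dist_bounded lipschitz_on_nonneg[OF F])
    finally show ?thesis .
  qed
  have "norm ((?P x s - ?P y s) - (?P x t0 - ?P y t0)) \<le> (L * dist x y) * \<bar>s - t0\<bar>"
    by (rule vector_derivative_bound
        [OF has_vector_derivative_diff[OF picard_deriv picard_deriv] dist_F])
      (use t0 s in auto)
  also have "\<dots> \<le> (L * dist x y) * (b - a)"
    using t0 s lipschitz_on_nonneg[OF F] by (intro mult_left_mono) auto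
  finally show ?thesis
    by (simp add: picard_map_initial dist_norm algebra_simps)
qed

lemma ode_solution_exists_if_lipschitz:
  fixes F :: "'a::euclidean_space \<Rightarrow> 'a"
  assumes F: "L-lipschitz_on UNIV F" and t0: "t0 \<in> {a..b}" and short: "(b - a) * L < 1"
  obtains u where "u t0 = u0" "\<forall>s\<in>{a..b}. (u has_vector_derivative F (u s)) (at s within {a..b})"
proof -
  note picard_deriv = picard_map_has_vector_derivative[OF lipschitz_on_continuous_on[OF F]
      continuous_on_apply_bcontfun t0]
  have "\<exists>y :: real \<Rightarrow>\<^sub>C 'a. \<forall>s. y s = picard_map F t0 u0 x (clamp a b s)" for x :: "real \<Rightarrow>\<^sub>C 'a"
  proof -
    have "continuous_on (cbox a b) (picard_map F t0 u0 x)"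
      using continuous_on_vector_derivative[OF picard_deriv] by (simp add: cbox_interval)
    then show ?thesis
      using continuous_on_cbox_bcontfunE by metis
  qed
  then obtain T :: "(real \<Rightarrow>\<^sub>C 'a) \<Rightarrow> (real \<Rightarrow>\<^sub>C 'a)"
    where T: "\<And>x s. T x s = picard_map F t0 u0 x (clamp a b s)"
    by metis
  have "clamp a b s \<in> {a..b}" for s
    using clamp_in_interval[of a b s] t0 by (simp add: cbox_interval)
  then have "dist (T x) (T y) \<le> (b - a) * L * dist x y" for x y
    by (intro dist_bound) (simp add: T dist_picard_map_le[OF F t0])
  then obtain u where "T u = u"
    using banach_fix_type[of "(b - a) * L" T] short t0 lipschitz_on_nonneg[OF F] by auto
  then have u_eq: "u s = picard_map F t0 u0 u s" if "s \<in> {a..b}" for s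
    using T[of u s] that by (simp add: cbox_interval)
  show ?thesis
  proof
    show "u t0 = u0"
      using u_eq[OF t0] by (simp add: picard_map_initial)
    show "\<forall>s\<in>{a..b}. (u has_vector_derivative F (u s)) (at s within {a..b})"
      using has_vector_derivative_transform[OF _ u_eq picard_deriv] by blast
  qed
qed

lemma lipschitz_on_closest_point:
  fixes f :: "'a::euclidean_space \<Rightarrow> 'b::metric_space"
  assumes "L-lipschitz_on S f" "convex S" "closed S" "S \<noteq> {}"
  shows "L-lipschitz_on UNIV (\<lambda>x. f (closest_point S x))"
proof -
  have "1-lipschitz_on UNIV (closest_point S)"
    using assms closest_point_lipschitz by (intro lipschitz_onI) auto
  moreover have "range (closest_point S) \<subseteq> S"
    using assms closest_point_in_set by blast
  ultimately have "(L * 1)-lipschitz_on UNIV (\<lambda>x. f (closest_point S x))"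
    by (intro lipschitz_on_compose2 lipschitz_on_subset[OF assms(1)])
  then show ?thesis by simp
qed

lemma ex_short_time:
  fixes r K L :: real
  assumes "r > 0" "K > 0" "L \<ge> 0"
  obtains \<epsilon> where "\<epsilon> > 0" "K * \<epsilon> \<le> r" "2 * \<epsilon> * L < 1"
proof
  define \<epsilon> where "\<epsilon> = min (r / K) (1 / (2 * L + 1))"
  show "\<epsilon> > 0"
    using assms by (simp add: \<epsilon>_def)
  have "K * \<epsilon> \<le> K * (r / K)"
    using assms by (intro mult_left_mono) (auto simp: \<epsilon>_def)
  then show "K * \<epsilon> \<le> r"
    using assms by simp
  have "\<epsilon> * (2 * L + 1) \<le> 1 / (2 * L + 1) * (2 * L + 1)"
    using assms by (intro mult_right_mono) (auto simp: \<epsilon>_def)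
  also have "\<dots> = 1"
    using assms by simp
  finally show "2 * \<epsilon> * L < 1"
    using \<open>\<epsilon> > 0\<close> by (simp add: algebra_simps)
qed

text \<open>Precomposition with the nearest-point retraction onto the ball makes the field globally
  Lipschitz; for short times the solution does not leave the ball, where nothing was changed.\<close>

lemma ode_local_existence:
  fixes f :: "'a::euclidean_space \<Rightarrow> 'a"
  assumes "r > 0" and lip: "L-lipschitz_on (cball x0 r) f"
  obtains \<epsilon> and u :: "real \<Rightarrow> 'a" where "\<epsilon> > 0" "u 0 = x0"
    "\<forall>s. \<bar>s\<bar> < \<epsilon> \<longrightarrow> u s \<in> cball x0 r \<and> (u has_vector_derivative f (u s)) (at s)"
proof -
  let ?p = "closest_point (cball x0 r)"
  have "bounded (f ` cball x0 r)"
    by (intro compact_imp_bounded compact_continuous_image compact_cball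
        lipschitz_on_continuous_on[OF lip])
  then obtain K where "K > 0" and f_bound: "\<And>x. x \<in> cball x0 r \<Longrightarrow> norm (f x) \<le> K"
    by (auto simp: bounded_pos)
  obtain \<epsilon> where "\<epsilon> > 0" "K * \<epsilon> \<le> r" "2 * \<epsilon> * L < 1"
    using ex_short_time[OF \<open>r > 0\<close> \<open>K > 0\<close> lipschitz_on_nonneg[OF lip]] .
  then have short: "(\<epsilon> - - \<epsilon>) * L < 1"
    by simp
  have retracted_lip: "L-lipschitz_on UNIV (\<lambda>x. f (?p x))"
    using lip \<open>r > 0\<close> by (intro lipschitz_on_closest_point) auto
  have zero_in: "0 \<in> {-\<epsilon>..\<epsilon>}"
    using \<open>\<epsilon> > 0\<close> by simp
  obtain u where "u 0 = x0"
    and u: "\<forall>s\<in>{-\<epsilon>..\<epsilon>}. (u has_vector_derivative f (?p (u s))) (at s within {-\<epsilon>..\<epsilon>})"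
    using ode_solution_exists_if_lipschitz[OF retracted_lip zero_in short] .
  have u_in: "u s \<in> cball x0 r" if "s \<in> {-\<epsilon>..\<epsilon>}" for s
  proof -
    have "?p x \<in> cball x0 r" for x
      using \<open>r > 0\<close> by (intro closest_point_in_set) auto
    then have u_bound: "norm (f (?p (u s))) \<le> K" for s
      by (rule f_bound)
    have "norm (u s - u 0) \<le> K * \<bar>s - 0\<bar>"
      by (rule vector_derivative_bound[OF bspec[OF u] u_bound]) (use \<open>\<epsilon> > 0\<close> that in auto)
    also have "\<dots> \<le> K * \<epsilon>"
      using that \<open>K > 0\<close> by (intro mult_left_mono) auto
    finally show ?thesis
      using \<open>K * \<epsilon> \<le> r\<close> \<open>u 0 = x0\<close> by (simp add: dist_norm norm_minus_commute)
  qed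
  have "u s \<in> cball x0 r \<and> (u has_vector_derivative f (u s)) (at s)" if "\<bar>s\<bar> < \<epsilon>" for s
  proof -
    have "s \<in> {-\<epsilon>..\<epsilon>}"
      using that by auto
    moreover have "at s within {-\<epsilon>..\<epsilon>} = at s"
      by (rule at_within_interior) (use that in auto)
    ultimately show ?thesis
      using u[rule_format, of s] u_in[of s] by (simp add: closest_point_self)
  qed
  with \<open>\<epsilon> > 0\<close> \<open>u 0 = x0\<close> show ?thesis
    using that by blast
qed

lemma vanishes_forward_if_derivative_dominated:
  fixes w :: "real \<Rightarrow> 'a::real_inner"
  assumes "s0 \<le> s" and w: "\<And>r. r \<in> {s0..s} \<Longrightarrow> (w has_vector_derivative w' r) (at r)"
    and dominated: "\<And>r. r \<in> {s0..s} \<Longrightarrow> norm (w' r) \<le> L * norm (w r)"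
    and "w s0 = 0"
  shows "w s = 0"
proof -
  let ?g = "\<lambda>r. exp (- 2 * L * r) * (w r \<bullet> w r)"
  have "?g s \<le> ?g s0"
  proof (rule DERIV_nonpos_imp_nonincreasing[OF \<open>s0 \<le> s\<close>])
    fix r assume "s0 \<le> r" "r \<le> s"
    then have r: "r \<in> {s0..s}" by simp
    note w_r = w[OF r, unfolded has_vector_derivative_def]
    have "(\<lambda>h. w r \<bullet> h *\<^sub>R w' r + h *\<^sub>R w' r \<bullet> w r) = (*) (2 * (w r \<bullet> w' r))"
      by (simp add: fun_eq_iff inner_commute)
    then have "((\<lambda>r. w r \<bullet> w r) has_real_derivative 2 * (w r \<bullet> w' r)) (at r)"
      using has_derivative_inner[OF w_r w_r] by (simp add: has_field_derivative_def)
    then have deriv: "DERIV ?g r :> exp (- 2 * L * r) * (- 2 * L * (w r \<bullet> w r) + 2 * (w r \<bullet> w' r))"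
      by (auto intro!: derivative_eq_intros simp: algebra_simps)
    have "w r \<bullet> w' r \<le> norm (w r) * norm (w' r)"
      by (rule norm_cauchy_schwarz)
    also have "\<dots> \<le> norm (w r) * (L * norm (w r))"
      using dominated[OF r] by (rule mult_left_mono) simp
    finally have "exp (- 2 * L * r) * (- 2 * L * (w r \<bullet> w r) + 2 * (w r \<bullet> w' r)) \<le> 0"
      by (intro mult_nonneg_nonpos) (simp_all add: dot_square_norm power2_eq_square algebra_simps)
    with deriv show "\<exists>y. DERIV ?g r :> y \<and> y \<le> 0"
      by blast
  qed
  then have "exp (- 2 * L * s) * (w s \<bullet> w s) \<le> 0"
    using \<open>w s0 = 0\<close> by simp
  then have "w s \<bullet> w s \<le> 0"
    by (simp only: mult_le_0_iff) (use exp_gt_zero[of "- 2 * L * s"] in linarith)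
  then show ?thesis
    using inner_eq_zero_iff[of "w s"] inner_ge_zero[of "w s"] by linarith
qed

lemma vanishes_if_derivative_dominated:
  fixes w :: "real \<Rightarrow> 'a::real_inner"
  assumes w: "\<And>r. r \<in> I \<Longrightarrow> (w has_vector_derivative w' r) (at r)"
    and dominated: "\<And>r. r \<in> I \<Longrightarrow> norm (w' r) \<le> L * norm (w r)"
    and I: "is_interval I" "s0 \<in> I" "s \<in> I" and "w s0 = 0"
  shows "w s = 0"
proof (cases "s0 \<le> s")
  case True
  then show ?thesis
    by (rule vanishes_forward_if_derivative_dominated)
      (use w dominated mem_is_interval_1_I[OF I] \<open>w s0 = 0\<close> in auto)
next
  case False
  have minus_in: "- r \<in> I" if "r \<in> {- s0..- s}" for r
    using mem_is_interval_1_I[OF I(1,3,2), of "- r"] that by simp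
  have "w (- (- s)) = 0"
  proof (rule vanishes_forward_if_derivative_dominated[where w="\<lambda>r. w (- r)"])
    fix r assume r: "r \<in> {- s0..- s}"
    have "(uminus has_vector_derivative - 1) (at r)"
      by (auto intro!: derivative_eq_intros)
    from vector_diff_chain_at[OF this w[OF minus_in[OF r]]]
    show "((\<lambda>r. w (- r)) has_vector_derivative - w' (- r)) (at r)"
      by (simp add: comp_def)
  next
    show "norm (- w' (- r)) \<le> L * norm (w (- r))" if "r \<in> {- s0..- s}" for r
      using dominated[OF minus_in[OF that]] by simp
  qed (use False \<open>w s0 = 0\<close> in simp_all)
  then show ?thesis by simp
qed

lemma ode_local_uniqueness:
  fixes u v :: "real \<Rightarrow> 'a::real_inner"
  assumes f: "L-lipschitz_on S f"
    and u: "\<forall>\<^sub>F s in nhds s0. u s \<in> S \<and> (u has_vector_derivative f (u s)) (at s)"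
    and v: "\<forall>\<^sub>F s in nhds s0. v s \<in> S \<and> (v has_vector_derivative f (v s)) (at s)"
    and initial: "u s0 = v s0"
  shows "\<forall>\<^sub>F s in nhds s0. u s = v s"
proof -
  obtain d where "d > 0" and near: "\<And>s. s \<in> ball s0 d \<Longrightarrow>
      u s \<in> S \<and> (u has_vector_derivative f (u s)) (at s) \<and>
      v s \<in> S \<and> (v has_vector_derivative f (v s)) (at s)"
    using eventually_conj[OF u v] unfolding eventually_nhds_metric by (auto simp: dist_commute)
  have "u s - v s = 0" if s: "s \<in> ball s0 d" for s
  proof (rule vanishes_if_derivative_dominated[of "ball s0 d"])
    show "((\<lambda>s. u s - v s) has_vector_derivative f (u s) - f (v s)) (at s)" if "s \<in> ball s0 d" for s
      using near[OF that] by (auto intro: has_vector_derivative_diff)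
    show "norm (f (u s) - f (v s)) \<le> L * norm (u s - v s)" if "s \<in> ball s0 d" for s
      using lipschitz_onD[OF f] near[OF that] by (simp add: dist_norm)
  qed (use s \<open>d > 0\<close> initial in \<open>auto simp: is_interval_ball_real\<close>)
  then show ?thesis
    using \<open>d > 0\<close> unfolding eventually_nhds_metric by (auto simp: dist_commute)
qed


section \<open>Charts\<close>

abbreviation prod_chart ::
  "('a, 'e) chart \<Rightarrow> ('b, 'f) chart \<Rightarrow> ('a \<times> 'b, 'e \<times> 'f) chart" where
  "prod_chart c d \<equiv> (dom_of c \<times> dom_of d, map_prod (coord c) (coord d))"

abbreviation id_chart :: "('e, 'e) chart" where
  "id_chart \<equiv> (UNIV, id)"

lemma is_chart_inj_on: "is_chart X c \<Longrightarrow> inj_on (coord c) (dom_of c)"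
  by (auto simp: is_chart_def homeomorphic_map_def topspace_subtopology dest: openin_subset
      intro: inj_on_subset)

lemma param_coord: "is_chart X c \<Longrightarrow> q \<in> dom_of c \<Longrightarrow> param c (coord c q) = q"
  by (simp add: param_def is_chart_inj_on)

lemma is_chart_open_image:
  assumes c_chart: "is_chart X c" and U: "openin X U"
  shows "open (coord c ` (dom_of c \<inter> U))"
proof -
  have "openin (subtopology X (dom_of c)) (dom_of c \<inter> U)"
    using U openin_subtopology_Int2 by blast
  then have "openin (top_of_set (coord c ` dom_of c)) (coord c ` (dom_of c \<inter> U))"
    using c_chart homeomorphic_imp_open_map unfolding is_chart_def open_map_def by blast
  then show ?thesis
    using c_chart openin_open_trans unfolding is_chart_def by blast
qed

lemma is_chart_eventually_in:
  assumes c_chart: "is_chart X c" and q: "q \<in> dom_of c" and U: "openin X U" "q \<in> U"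
  shows "\<forall>\<^sub>F y in nhds (coord c q). y \<in> coord c ` (dom_of c \<inter> U)"
  using is_chart_open_image[OF c_chart U(1)] q U(2) by (intro eventually_nhds_in_open) auto

lemma is_chart_eventually_param:
  assumes c_chart: "is_chart X c" and "q \<in> dom_of c"
  shows "\<forall>\<^sub>F y in nhds (coord c q). param c y \<in> dom_of c \<and> coord c (param c y) = y"
proof -
  have "openin X (dom_of c)"
    using c_chart by (simp add: is_chart_def)
  from is_chart_eventually_in[OF assms this assms(2)] show ?thesis
    by eventually_elim (use param_coord[OF c_chart] in auto)
qed

lemma is_chart_prod:
  assumes c_chart: "is_chart X c" and d_chart: "is_chart Y d"
  shows "is_chart (prod_topology X Y) (prod_chart c d)"
proof -
  obtain c' d' where
    "homeomorphic_maps (subtopology X (dom_of c)) (top_of_set (coord c ` dom_of c)) (coord c) c'"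
    "homeomorphic_maps (subtopology Y (dom_of d)) (top_of_set (coord d ` dom_of d)) (coord d) d'"
    using c_chart d_chart unfolding is_chart_def homeomorphic_map_maps by blast
  then have "homeomorphic_maps
      (prod_topology (subtopology X (dom_of c)) (subtopology Y (dom_of d)))
      (prod_topology (top_of_set (coord c ` dom_of c)) (top_of_set (coord d ` dom_of d)))
      (\<lambda>(x, y). (coord c x, coord d y)) (\<lambda>(x, y). (c' x, d' y))"
    by (subst homeomorphic_maps_prod) simp
  then have "homeomorphic_map
      (subtopology (prod_topology X Y) (dom_of c \<times> dom_of d))
      (top_of_set (coord c ` dom_of c \<times> coord d ` dom_of d)) (map_prod (coord c) (coord d))"
    unfolding homeomorphic_map_maps map_prod_def by (auto simp: subtopology_Times)
  moreover have "map_prod (coord c) (coord d) ` (dom_of c \<times> dom_of d) =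
      coord c ` dom_of c \<times> coord d ` dom_of d"
    by force
  ultimately show ?thesis
    using c_chart d_chart by (simp add: is_chart_def openin_prod_Times_iff open_Times)
qed

lemma is_chart_euclidean: "is_chart euclidean (id_chart :: ('e::euclidean_space, 'e) chart)"
  by (simp add: is_chart_def)

lemma param_id_chart: "param id_chart = id"
  by (simp add: param_def)


section \<open>Derivatives in charts\<close>

lemma has_derivative_transform_nhds:
  assumes "(f has_derivative A) (at x)" "\<forall>\<^sub>F y in nhds x. f y = g y"
  shows "(g has_derivative A) (at x)"
  using assms by (auto simp: eventually_nhds intro: has_derivative_transform_within_open)

lemma has_derivative_imp_tendsto_nhds:
  assumes "(f has_derivative A) (at x)"
  shows "(f \<longlongrightarrow> f x) (nhds x)"
  using has_derivative_continuous[OF assms] by (simp only: isCont_def tendsto_at_iff_tendsto_nhds)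

text \<open>The membership condition is continuity of \<open>f\<close> at \<open>q\<close>: since \<open>coord d\<close> is arbitrary outside
  \<open>dom_of d\<close>, differentiability of the coordinate expression alone gives no chain rule.\<close>

definition has_chart_derivative ::
  "('a, 'e::real_normed_vector) chart \<Rightarrow> ('b, 'f::real_normed_vector) chart \<Rightarrow> ('a \<Rightarrow> 'b) \<Rightarrow> 'a \<Rightarrow>
     ('e \<Rightarrow> 'f) \<Rightarrow> bool" where
  "has_chart_derivative c d f q A \<longleftrightarrow>
     (\<forall>\<^sub>F y in nhds (coord c q). f (param c y) \<in> dom_of d) \<and>
     ((coord d \<circ> f \<circ> param c) has_derivative A) (at (coord c q))"

lemma has_chart_derivative_eventually_in:
  "has_chart_derivative c d f q A \<Longrightarrow> \<forall>\<^sub>F y in nhds (coord c q). f (param c y) \<in> dom_of d"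
  by (simp add: has_chart_derivative_def)

lemma has_chart_derivative_has_derivative:
  "has_chart_derivative c d f q A \<Longrightarrow> ((coord d \<circ> f \<circ> param c) has_derivative A) (at (coord c q))"
  by (simp add: has_chart_derivative_def)

lemma has_chart_derivative_frechet:
  "has_chart_derivative c d f q A \<Longrightarrow>
     frechet_derivative (coord d \<circ> f \<circ> param c) (at (coord c q)) = A"
  by (rule frechet_derivative_at[symmetric]) (rule has_chart_derivative_has_derivative)

lemma has_chart_derivative_linear: "has_chart_derivative c d f q A \<Longrightarrow> linear A"
  using has_derivative_linear[OF has_chart_derivative_has_derivative] .

lemma has_chart_derivative_unique:
  "has_chart_derivative c d f q A \<Longrightarrow> has_chart_derivative c d f q B \<Longrightarrow> A = B"
  using has_derivative_unique[OF has_chart_derivative_has_derivative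
      has_chart_derivative_has_derivative] .

lemma has_chart_derivative_transform:
  assumes f: "has_chart_derivative c d f q A"
    and f_eq_g: "\<forall>\<^sub>F y in nhds (coord c q). f (param c y) = g (param c y)"
  shows "has_chart_derivative c d g q A"
  unfolding has_chart_derivative_def
proof
  show "\<forall>\<^sub>F y in nhds (coord c q). g (param c y) \<in> dom_of d"
    using has_chart_derivative_eventually_in[OF f] f_eq_g by eventually_elim simp
  show "((coord d \<circ> g \<circ> param c) has_derivative A) (at (coord c q))"
    using has_chart_derivative_has_derivative[OF f]
    by (rule has_derivative_transform_nhds) (use f_eq_g in \<open>auto elim: eventually_mono\<close>)
qed

lemma has_chart_derivative_compose:
  assumes c_chart: "is_chart X c" "q \<in> dom_of c" and d_chart: "is_chart Y d"
    and f: "has_chart_derivative c d f q A" and g: "has_chart_derivative d e g (f q) B"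
  shows "has_chart_derivative c e (\<lambda>x. g (f x)) q (\<lambda>v. B (A v))"
proof -
  let ?f = "coord d \<circ> f \<circ> param c" and ?g = "coord e \<circ> g \<circ> param d"
  have f_q: "coord d (f q) = ?f (coord c q)"
    by (simp add: param_coord[OF c_chart])
  have param_f: "\<forall>\<^sub>F y in nhds (coord c q). param d (?f y) = f (param c y)"
    using has_chart_derivative_eventually_in[OF f]
    by eventually_elim (simp add: param_coord[OF d_chart])
  have "\<forall>\<^sub>F y in nhds (?f (coord c q)). g (param d y) \<in> dom_of e"
    using has_chart_derivative_eventually_in[OF g] by (simp only: f_q)
  then have "\<forall>\<^sub>F y in nhds (coord c q). g (param d (?f y)) \<in> dom_of e"
    by (rule eventually_compose_filterlim
        [OF _ has_derivative_imp_tendsto_nhds[OF has_chart_derivative_has_derivative[OF f]]])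
  with param_f have "\<forall>\<^sub>F y in nhds (coord c q). g (f (param c y)) \<in> dom_of e"
    by eventually_elim simp
  moreover have "((\<lambda>y. ?g (?f y)) has_derivative (\<lambda>v. B (A v))) (at (coord c q))"
    using has_chart_derivative_has_derivative[OF f] has_chart_derivative_has_derivative[OF g]
    unfolding f_q by (rule has_derivative_compose)
  then have "((coord e \<circ> (\<lambda>x. g (f x)) \<circ> param c) has_derivative (\<lambda>v. B (A v))) (at (coord c q))"
    by (rule has_derivative_transform_nhds) (use param_f in \<open>auto elim: eventually_mono\<close>)
  ultimately show ?thesis
    by (simp add: has_chart_derivative_def)
qed

lemma has_chart_derivative_Pair:
  assumes "has_chart_derivative c d f q A" "has_chart_derivative c e g q B"
  shows "has_chart_derivative c (prod_chart d e) (\<lambda>x. (f x, g x)) q (\<lambda>v. (A v, B v))"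
  using assms
  by (auto simp: has_chart_derivative_def comp_def eventually_conj_iff intro: has_derivative_Pair)

lemma has_chart_derivative_const:
  "z \<in> dom_of d \<Longrightarrow> has_chart_derivative c d (\<lambda>_. z) q (\<lambda>_. 0)"
  by (simp add: has_chart_derivative_def comp_def)

lemma has_chart_derivative_bounded_linear:
  assumes c_chart: "is_chart X c" "q \<in> dom_of c" and A_linear: "bounded_linear A"
    and f: "\<And>p. p \<in> dom_of c \<Longrightarrow> f p \<in> dom_of d \<and> coord d (f p) = A (coord c p)"
  shows "has_chart_derivative c d f q A"
  unfolding has_chart_derivative_def
proof
  show "\<forall>\<^sub>F y in nhds (coord c q). f (param c y) \<in> dom_of d"
    using is_chart_eventually_param[OF c_chart] by eventually_elim (use f in auto)
  have "\<forall>\<^sub>F y in nhds (coord c q). A y = (coord d \<circ> f \<circ> param c) y"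
    using is_chart_eventually_param[OF c_chart] by eventually_elim (use f in auto)
  then show "((coord d \<circ> f \<circ> param c) has_derivative A) (at (coord c q))"
    by (rule has_derivative_transform_nhds[OF bounded_linear_imp_has_derivative[OF A_linear]])
qed

lemma has_chart_derivative_ident:
  "is_chart X c \<Longrightarrow> q \<in> dom_of c \<Longrightarrow> has_chart_derivative c c (\<lambda>x. x) q (\<lambda>v. v)"
  by (rule has_chart_derivative_bounded_linear[OF _ _ bounded_linear_ident]) auto

lemma has_chart_derivative_fst:
  assumes "is_chart X c" "is_chart Y d" "z \<in> dom_of c \<times> dom_of d"
  shows "has_chart_derivative (prod_chart c d) c fst z fst"
  by (rule has_chart_derivative_bounded_linear
      [OF is_chart_prod[OF assms(1,2)] _ bounded_linear_fst]) (use assms(3) in auto)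

lemma has_chart_derivative_snd:
  assumes "is_chart X c" "is_chart Y d" "z \<in> dom_of c \<times> dom_of d"
  shows "has_chart_derivative (prod_chart c d) d snd z snd"
  by (rule has_chart_derivative_bounded_linear
      [OF is_chart_prod[OF assms(1,2)] _ bounded_linear_snd]) (use assms(3) in auto)

lemma has_chart_derivative_map_prod:
  assumes c_chart: "is_chart X c" "fst z \<in> dom_of c" and d_chart: "is_chart Y d" "snd z \<in> dom_of d"
    and f: "has_chart_derivative c c' f (fst z) A" and g: "has_chart_derivative d d' g (snd z) B"
  shows "has_chart_derivative (prod_chart c d) (prod_chart c' d') (\<lambda>z. (f (fst z), g (snd z))) z
    (\<lambda>v. (A (fst v), B (snd v)))"
proof -
  have z: "z \<in> dom_of c \<times> dom_of d" "z \<in> dom_of (prod_chart c d)"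
    using c_chart(2) d_chart(2) by (auto simp: mem_Times_iff)
  note compose = has_chart_derivative_compose[OF is_chart_prod[OF c_chart(1) d_chart(1)] z(2)]
  show ?thesis
    by (rule has_chart_derivative_Pair
        [OF compose[OF c_chart(1) has_chart_derivative_fst[OF c_chart(1) d_chart(1) z(1)] f]
          compose[OF d_chart(1) has_chart_derivative_snd[OF c_chart(1) d_chart(1) z(1)] g]])
qed

lemma has_chart_derivative_partial_fst:
  assumes c_chart: "is_chart X c" "x \<in> dom_of c" and d_chart: "is_chart Y d" "y \<in> dom_of d"
    and B_deriv: "has_chart_derivative (prod_chart c d) e f (x, y) B"
  shows "has_chart_derivative c e (\<lambda>x. f (x, y)) x (\<lambda>v. B (v, 0))"
  by (rule has_chart_derivative_compose[OF c_chart is_chart_prod[OF c_chart(1) d_chart(1)]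
        has_chart_derivative_Pair[OF has_chart_derivative_ident[OF c_chart]
          has_chart_derivative_const[OF d_chart(2)]] B_deriv])

lemma has_chart_derivative_partial_snd:
  assumes c_chart: "is_chart X c" "x \<in> dom_of c" and d_chart: "is_chart Y d" "y \<in> dom_of d"
    and B_deriv: "has_chart_derivative (prod_chart c d) e f (x, y) B"
  shows "has_chart_derivative d e (\<lambda>y. f (x, y)) y (\<lambda>v. B (0, v))"
  by (rule has_chart_derivative_compose[OF d_chart is_chart_prod[OF c_chart(1) d_chart(1)]
        has_chart_derivative_Pair[OF has_chart_derivative_const[OF c_chart(2)]
          has_chart_derivative_ident[OF d_chart]] B_deriv])


section \<open>Differentiable manifolds and maps\<close>

text \<open>With smooth transition maps replaced by differentiable ones, closure under products follows
  from the chain rule; first derivatives are all that tangent maps and velocities need.\<close>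

definition differentiable_manifold :: "('a, 'e::euclidean_space) mfd \<Rightarrow> bool" where
  "differentiable_manifold M \<longleftrightarrow>
     (\<forall>c\<in>atlas M. is_chart (mfd_top M) c) \<and>
     (\<Union>c\<in>atlas M. dom_of c) = points M \<and>
     (\<forall>q. \<forall>c\<in>charts_at M q. \<forall>d\<in>charts_at M q. \<exists>A. has_chart_derivative c d (\<lambda>x. x) q A)"

lemma charts_atD:
  assumes "differentiable_manifold M" "c \<in> charts_at M q"
  shows "is_chart (mfd_top M) c" "q \<in> dom_of c" "q \<in> points M"
  using assms by (auto simp: differentiable_manifold_def charts_at_def)

lemma dom_of_subset_points:
  "differentiable_manifold M \<Longrightarrow> c \<in> charts_at M q \<Longrightarrow> dom_of c \<subseteq> points M"
  by (auto simp: differentiable_manifold_def charts_at_def)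

lemma charts_at_dom_of: "c \<in> charts_at M q \<Longrightarrow> p \<in> dom_of c \<Longrightarrow> c \<in> charts_at M p"
  by (simp add: charts_at_def)

lemma chart_at_in_charts_at:
  assumes "differentiable_manifold M" "q \<in> points M"
  shows "chart_at M q \<in> charts_at M q"
proof -
  have "charts_at M q \<noteq> {}"
    using assms unfolding differentiable_manifold_def charts_at_def by blast
  then show ?thesis
    unfolding chart_at_def by (rule some_in_eq[THEN iffD2])
qed

lemma transition_has_chart_derivative:
  assumes "differentiable_manifold M" "c \<in> charts_at M q" "d \<in> charts_at M q"
  obtains A where "has_chart_derivative c d (\<lambda>x. x) q A"
  using assms unfolding differentiable_manifold_def by blast

lemma atlas_prod: "atlas (prod_mfd M N) = {prod_chart c d | c d. c \<in> atlas M \<and> d \<in> atlas N}"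
  by (simp add: prod_mfd_def)

lemma mfd_top_prod: "mfd_top (prod_mfd M N) = prod_topology (mfd_top M) (mfd_top N)"
  by (simp add: prod_mfd_def)

lemma points_prod: "points (prod_mfd M N) = points M \<times> points N"
  by (simp add: mfd_top_prod)

lemma prod_chart_in_charts_at:
  assumes "c \<in> charts_at M (fst z)" "d \<in> charts_at N (snd z)"
  shows "prod_chart c d \<in> charts_at (prod_mfd M N) z"
proof -
  have "prod_chart c d \<in> atlas (prod_mfd M N)"
    using assms unfolding atlas_prod charts_at_def by blast
  then show ?thesis
    using assms by (simp add: charts_at_def mem_Times_iff)
qed

lemma charts_at_prodE:
  assumes "C \<in> charts_at (prod_mfd M N) z"
  obtains c d where "C = prod_chart c d" "c \<in> charts_at M (fst z)" "d \<in> charts_at N (snd z)"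
proof -
  obtain c d where C_eq: "C = prod_chart c d" and "c \<in> atlas M" "d \<in> atlas N" "z \<in> dom_of C"
    using assms unfolding atlas_prod charts_at_def by blast
  then show ?thesis
    using that[OF C_eq] by (simp add: charts_at_def mem_Times_iff)
qed

lemma differentiable_manifold_prod:
  assumes M: "differentiable_manifold M" and N: "differentiable_manifold N"
  shows "differentiable_manifold (prod_mfd M N)"
  unfolding differentiable_manifold_def
proof (intro conjI allI ballI)
  fix C assume "C \<in> atlas (prod_mfd M N)"
  then obtain c d where "C = prod_chart c d" "c \<in> atlas M" "d \<in> atlas N"
    unfolding atlas_prod by blast
  then show "is_chart (mfd_top (prod_mfd M N)) C"
    using M N is_chart_prod[of _ c _ d] by (simp add: mfd_top_prod differentiable_manifold_def)
next
  show "(\<Union>C\<in>atlas (prod_mfd M N). dom_of C) = points (prod_mfd M N)"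
  proof (intro equalityI subsetI)
    fix z assume "z \<in> points (prod_mfd M N)"
    then have "prod_chart (chart_at M (fst z)) (chart_at N (snd z)) \<in> charts_at (prod_mfd M N) z"
      by (intro prod_chart_in_charts_at chart_at_in_charts_at M N) (auto simp: points_prod)
    then show "z \<in> (\<Union>C\<in>atlas (prod_mfd M N). dom_of C)"
      unfolding charts_at_def by blast
  next
    fix z assume "z \<in> (\<Union>C\<in>atlas (prod_mfd M N). dom_of C)"
    then obtain C where "C \<in> charts_at (prod_mfd M N) z"
      unfolding charts_at_def by blast
    then show "z \<in> points (prod_mfd M N)"
      using charts_atD(3)[OF M] charts_atD(3)[OF N]
      by (auto simp: points_prod mem_Times_iff elim: charts_at_prodE)
  qed
next
  fix z C C'
  assume "C \<in> charts_at (prod_mfd M N) z" "C' \<in> charts_at (prod_mfd M N) z"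
  then obtain c d c' d' where C_eq: "C = prod_chart c d" "C' = prod_chart c' d'"
    and c_at: "c \<in> charts_at M (fst z)" "c' \<in> charts_at M (fst z)"
    and d_at: "d \<in> charts_at N (snd z)" "d' \<in> charts_at N (snd z)"
    by (elim charts_at_prodE) metis
  obtain A B where "has_chart_derivative c c' (\<lambda>x. x) (fst z) A"
    "has_chart_derivative d d' (\<lambda>y. y) (snd z) B"
    using transition_has_chart_derivative[OF M c_at] transition_has_chart_derivative[OF N d_at]
    by metis
  then have "has_chart_derivative C C' (\<lambda>z. (fst z, snd z)) z (\<lambda>v. (A (fst v), B (snd v)))"
    unfolding C_eq using charts_atD(1,2)[OF M c_at(1)] charts_atD(1,2)[OF N d_at(1)]
    by (intro has_chart_derivative_map_prod)
  then show "\<exists>A. has_chart_derivative C C' (\<lambda>z. z) z A"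
    by auto
qed

lemma charts_at_euclidean: "charts_at euclidean_mfd x = {id_chart}"
  by (auto simp: charts_at_def euclidean_mfd_def)

lemma differentiable_manifold_euclidean: "differentiable_manifold euclidean_mfd"
  using is_chart_euclidean has_chart_derivative_ident[OF is_chart_euclidean]
  by (auto simp: differentiable_manifold_def charts_at_euclidean) (auto simp: euclidean_mfd_def)

lemma has_chart_derivative_compose_at:
  assumes "differentiable_manifold M" "c \<in> charts_at M q"
    and "differentiable_manifold N" "d \<in> charts_at N p"
    and "has_chart_derivative c d f q A" "has_chart_derivative d e g (f q) B"
  shows "has_chart_derivative c e (\<lambda>x. g (f x)) q (\<lambda>v. B (A v))"
  by (rule has_chart_derivative_compose
      [OF charts_atD(1,2)[OF assms(1,2)] charts_atD(1)[OF assms(3,4)] assms(5,6)])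

definition differentiable_map_at ::
  "('a, 'e::euclidean_space) mfd \<Rightarrow> ('b, 'f::euclidean_space) mfd \<Rightarrow> ('a \<Rightarrow> 'b) \<Rightarrow> 'a \<Rightarrow> bool" where
  "differentiable_map_at M N f q \<longleftrightarrow>
     q \<in> points M \<and> f q \<in> points N \<and>
     (\<forall>c\<in>charts_at M q. \<forall>d\<in>charts_at N (f q). \<exists>A. has_chart_derivative c d f q A)"

lemma differentiable_map_atE:
  assumes "differentiable_map_at M N f q" "c \<in> charts_at M q" "d \<in> charts_at N (f q)"
  obtains A where "has_chart_derivative c d f q A"
  using assms unfolding differentiable_map_at_def by blast

lemma differentiable_map_at_chartI:
  assumes M: "differentiable_manifold M" and N: "differentiable_manifold N"
    and c_at: "c \<in> charts_at M q" and A_deriv: "has_chart_derivative c d f q A"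
    and d_at: "d \<in> charts_at N (f q)"
  shows "differentiable_map_at M N f q"
  unfolding differentiable_map_at_def
proof (intro conjI ballI)
  show "q \<in> points M" "f q \<in> points N"
    using charts_atD(3)[OF M c_at] charts_atD(3)[OF N d_at] .
  fix c' d' assume c'_at: "c' \<in> charts_at M q" and d'_at: "d' \<in> charts_at N (f q)"
  obtain S where S_deriv: "has_chart_derivative c' c (\<lambda>x. x) q S"
    using transition_has_chart_derivative[OF M c'_at c_at] .
  obtain T where T_deriv: "has_chart_derivative d d' (\<lambda>y. y) (f q) T"
    using transition_has_chart_derivative[OF N d_at d'_at] .
  have "has_chart_derivative c' d f q (\<lambda>v. A (S v))"
    by (rule has_chart_derivative_compose_at[OF M c'_at M c_at S_deriv A_deriv])
  from has_chart_derivative_compose_at[OF M c'_at N d_at this T_deriv]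
  show "\<exists>A. has_chart_derivative c' d' f q A"
    by blast
qed

lemma has_chart_derivative_transform_points:
  assumes M: "differentiable_manifold M" and c_at: "c \<in> charts_at M q"
    and f: "has_chart_derivative c d f q A" and f_eq_g: "\<And>x. x \<in> points M \<Longrightarrow> f x = g x"
  shows "has_chart_derivative c d g q A"
proof (rule has_chart_derivative_transform[OF f])
  show "\<forall>\<^sub>F y in nhds (coord c q). f (param c y) = g (param c y)"
    using is_chart_eventually_param[OF charts_atD(1,2)[OF M c_at]]
    by eventually_elim (use f_eq_g dom_of_subset_points[OF M c_at] in auto)
qed

lemma differentiable_map_at_compose:
  assumes M: "differentiable_manifold M" and N: "differentiable_manifold N"
    and f: "differentiable_map_at M N f q" and g: "differentiable_map_at N P g (f q)"
  shows "differentiable_map_at M P (\<lambda>x. g (f x)) q"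
  unfolding differentiable_map_at_def
proof (intro conjI ballI)
  show "q \<in> points M" "g (f q) \<in> points P"
    using f g by (auto simp: differentiable_map_at_def)
  fix c e assume c_at: "c \<in> charts_at M q" and e_at: "e \<in> charts_at P (g (f q))"
  have d_at: "chart_at N (f q) \<in> charts_at N (f q)"
    using f by (intro chart_at_in_charts_at[OF N]) (simp add: differentiable_map_at_def)
  obtain A B where "has_chart_derivative c (chart_at N (f q)) f q A"
    "has_chart_derivative (chart_at N (f q)) e g (f q) B"
    using differentiable_map_atE[OF f c_at d_at] differentiable_map_atE[OF g d_at e_at] by metis
  from has_chart_derivative_compose_at[OF M c_at N d_at this]
  show "\<exists>A. has_chart_derivative c e (\<lambda>x. g (f x)) q A"
    by blast
qed

lemma differentiable_map_at_Pair:
  assumes f: "differentiable_map_at M N f q" and g: "differentiable_map_at M P g q"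
  shows "differentiable_map_at M (prod_mfd N P) (\<lambda>x. (f x, g x)) q"
  unfolding differentiable_map_at_def
proof (intro conjI ballI)
  show "q \<in> points M" "(f q, g q) \<in> points (prod_mfd N P)"
    using f g by (auto simp: differentiable_map_at_def points_prod)
  fix c D assume c_at: "c \<in> charts_at M q" and D_at: "D \<in> charts_at (prod_mfd N P) (f q, g q)"
  obtain d e where D_eq: "D = prod_chart d e" "d \<in> charts_at N (f q)" "e \<in> charts_at P (g q)"
    using D_at by (auto elim: charts_at_prodE)
  obtain A B where "has_chart_derivative c d f q A" "has_chart_derivative c e g q B"
    using differentiable_map_atE[OF f c_at D_eq(2)] differentiable_map_atE[OF g c_at D_eq(3)]
    by metis
  from has_chart_derivative_Pair[OF this]
  show "\<exists>A. has_chart_derivative c D (\<lambda>x. (f x, g x)) q A"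
    unfolding D_eq(1) by blast
qed

lemma differentiable_map_at_const:
  assumes "differentiable_manifold N" "q \<in> points M" "z \<in> points N"
  shows "differentiable_map_at M N (\<lambda>_. z) q"
  unfolding differentiable_map_at_def
proof (intro conjI ballI)
  fix c d assume "d \<in> charts_at N z"
  then have "z \<in> dom_of d"
    by (rule charts_atD(2)[OF assms(1)])
  then show "\<exists>A. has_chart_derivative c d (\<lambda>_. z) q A"
    by (intro exI[of _ "\<lambda>_. 0"]) (rule has_chart_derivative_const)
qed (use assms in auto)

lemma differentiable_map_at_ident:
  "differentiable_manifold M \<Longrightarrow> q \<in> points M \<Longrightarrow> differentiable_map_at M M (\<lambda>x. x) q"
  by (simp add: differentiable_map_at_def differentiable_manifold_def)

lemma differentiable_map_at_fst:
  assumes M: "differentiable_manifold M" and N: "differentiable_manifold N"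
    and z: "z \<in> points (prod_mfd M N)"
  shows "differentiable_map_at (prod_mfd M N) M fst z"
proof -
  let ?c = "chart_at M (fst z)" and ?d = "chart_at N (snd z)"
  have c_at: "?c \<in> charts_at M (fst z)" and d_at: "?d \<in> charts_at N (snd z)"
    using z by (auto simp: points_prod intro: chart_at_in_charts_at M N)
  have "has_chart_derivative (prod_chart ?c ?d) ?c fst z fst"
    using charts_atD[OF M c_at] charts_atD[OF N d_at]
    by (intro has_chart_derivative_fst) (auto simp: mem_Times_iff)
  from differentiable_map_at_chartI
    [OF differentiable_manifold_prod[OF M N] M prod_chart_in_charts_at[OF c_at d_at] this c_at]
  show ?thesis .
qed

lemma differentiable_map_at_snd:
  assumes M: "differentiable_manifold M" and N: "differentiable_manifold N"
    and z: "z \<in> points (prod_mfd M N)"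
  shows "differentiable_map_at (prod_mfd M N) N snd z"
proof -
  let ?c = "chart_at M (fst z)" and ?d = "chart_at N (snd z)"
  have c_at: "?c \<in> charts_at M (fst z)" and d_at: "?d \<in> charts_at N (snd z)"
    using z by (auto simp: points_prod intro: chart_at_in_charts_at M N)
  have "has_chart_derivative (prod_chart ?c ?d) ?d snd z snd"
    using charts_atD[OF M c_at] charts_atD[OF N d_at]
    by (intro has_chart_derivative_snd) (auto simp: mem_Times_iff)
  from differentiable_map_at_chartI
    [OF differentiable_manifold_prod[OF M N] N prod_chart_in_charts_at[OF c_at d_at] this d_at]
  show ?thesis .
qed

lemma differentiable_map_at_partial_fst:
  assumes M: "differentiable_manifold M" and N: "differentiable_manifold N"
    and f: "differentiable_map_at (prod_mfd M N) P f (x, y)"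
  shows "differentiable_map_at M P (\<lambda>x. f (x, y)) x"
proof -
  have "x \<in> points M" "y \<in> points N"
    using f by (auto simp: differentiable_map_at_def points_prod)
  then have "differentiable_map_at M (prod_mfd M N) (\<lambda>x. (x, y)) x"
    by (intro differentiable_map_at_Pair differentiable_map_at_ident
        differentiable_map_at_const M N)
  from differentiable_map_at_compose[OF M differentiable_manifold_prod[OF M N] this f]
  show ?thesis .
qed

lemma differentiable_map_at_partial_snd:
  assumes M: "differentiable_manifold M" and N: "differentiable_manifold N"
    and f: "differentiable_map_at (prod_mfd M N) P f (x, y)"
  shows "differentiable_map_at N P (\<lambda>y. f (x, y)) y"
proof -
  have "x \<in> points M" "y \<in> points N"
    using f by (auto simp: differentiable_map_at_def points_prod)
  then have "differentiable_map_at N (prod_mfd M N) (\<lambda>y. (x, y)) y"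
    by (intro differentiable_map_at_Pair differentiable_map_at_ident
        differentiable_map_at_const M N)
  from differentiable_map_at_compose[OF N differentiable_manifold_prod[OF M N] this f]
  show ?thesis .
qed

lemma Cr_map_chart_domain_open:
  assumes "\<forall>c\<in>atlas M. is_chart (mfd_top M) c" "\<forall>d\<in>atlas N. is_chart (mfd_top N) d"
    and "Cr_map r M N f" "c \<in> atlas M" "d \<in> atlas N"
  shows "open (coord c ` (dom_of c \<inter> f -` dom_of d))"
proof -
  let ?U = "{x \<in> points M. f x \<in> dom_of d}"
  have c_chart: "is_chart (mfd_top M) c" and "openin (mfd_top N) (dom_of d)"
    using assms by (auto simp: is_chart_def)
  then have "openin (mfd_top M) ?U"
    using assms(3) openin_continuous_map_preimage unfolding Cr_map_def by blast
  moreover have "dom_of c \<inter> f -` dom_of d = dom_of c \<inter> ?U"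
    using c_chart openin_subset unfolding is_chart_def by fastforce
  ultimately show ?thesis
    using is_chart_open_image[OF c_chart] by metis
qed

lemma Cr_map_has_chart_derivative:
  assumes M: "\<forall>c\<in>atlas M. is_chart (mfd_top M) c" and N: "\<forall>d\<in>atlas N. is_chart (mfd_top N) d"
    and f: "Cr_map r M N f" "1 \<le> r" and c_at: "c \<in> charts_at M q" and d_at: "d \<in> charts_at N (f q)"
  shows "has_chart_derivative c d f q (frechet_derivative (coord d \<circ> f \<circ> param c) (at (coord c q)))"
proof -
  let ?S = "coord c ` (dom_of c \<inter> f -` dom_of d)"
  have cd_atlas: "c \<in> atlas M" "d \<in> atlas N" "q \<in> dom_of c" "f q \<in> dom_of d"
    using c_at d_at by (auto simp: charts_at_def)
  have S_open: "open ?S" "coord c q \<in> ?S"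
    using Cr_map_chart_domain_open[OF M N f(1) cd_atlas(1,2)] cd_atlas by auto
  have "Cr_on r ?S (coord d \<circ> f \<circ> param c)"
    using f cd_atlas unfolding Cr_map_def by blast
  then have "times_differentiable_on (Suc 0) ?S (coord d \<circ> f \<circ> param c)"
    using f(2) unfolding Cr_on_def one_enat_def One_nat_def by blast
  then have "(coord d \<circ> f \<circ> param c) differentiable (at (coord c q))"
    using S_open unfolding times_differentiable_on.simps by blast
  moreover have "\<forall>\<^sub>F y in nhds (coord c q). f (param c y) \<in> dom_of d"
    using eventually_nhds_in_open[OF S_open]
    by eventually_elim (use M cd_atlas param_coord[of "mfd_top M" c] in auto)
  ultimately show ?thesis
    by (simp add: has_chart_derivative_def frechet_derivative_works)
qed

lemma Cr_map_partial_derivative_local_lipschitz: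
  fixes M :: "('a, 'e::euclidean_space) mfd" and N :: "('b, 'f::euclidean_space) mfd"
    and P :: "('c, 'e) mfd"
  assumes M: "differentiable_manifold M" and N: "differentiable_manifold N"
    and P: "differentiable_manifold P"
    and f: "Cr_map r (prod_mfd M N) P f" "2 \<le> r"
    and charts: "c \<in> atlas M" "d \<in> atlas N" "e \<in> atlas P"
  defines "S \<equiv> coord (prod_chart c d) ` (dom_of (prod_chart c d) \<inter> f -` dom_of e)"
  shows "local_lipschitz (UNIV :: real set) {y. (y, z) \<in> S}
    (\<lambda>_ y. frechet_derivative (coord e \<circ> f \<circ> param (prod_chart c d)) (at (y, z)) w)"
proof (rule times_differentiable_on_1_imp_local_lipschitz)
  let ?F = "coord e \<circ> f \<circ> param (prod_chart c d)"
  have cd_atlas: "prod_chart c d \<in> atlas (prod_mfd M N)"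
    using charts unfolding atlas_prod by blast
  have "open S"
    unfolding S_def using f(1) cd_atlas charts(3)
    by (rule Cr_map_chart_domain_open[rotated 2])
      (use P differentiable_manifold_prod[OF M N] in \<open>simp_all add: differentiable_manifold_def\<close>)
  then show "open {y. (y, z) \<in> S}"
    using open_vimage[of S "\<lambda>y. (y, z)"] by (simp add: vimage_def continuous_intros)
  have "Cr_on r S ?F"
    using f(1) cd_atlas charts(3) unfolding Cr_map_def S_def by blast
  moreover have "enat (Suc (Suc 0)) \<le> r"
    using f(2) by (simp add: numeral_eq_enat flip: numeral_2_eq_2)
  ultimately have "times_differentiable_on (Suc (Suc 0)) S ?F"
    unfolding Cr_on_def by blast
  then have "times_differentiable_on (Suc 0) S (\<lambda>z. frechet_derivative ?F (at z) w)"
    unfolding times_differentiable_on.simps(2)[of "Suc 0"] by blast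
  then show "times_differentiable_on (Suc 0) {y. (y, z) \<in> S}
      (\<lambda>y. frechet_derivative ?F (at (y, z)) w)"
    by (rule times_differentiable_on_1_Pair_const)
qed

lemma smooth_manifold_imp_differentiable_manifold:
  assumes M: "smooth_manifold M"
  shows "differentiable_manifold M"
proof -
  have charts: "\<forall>c\<in>atlas M. is_chart (mfd_top M) c"
    using M by (simp add: smooth_manifold_def)
  have ident: "Cr_map \<infinity> M M (\<lambda>x. x)"
    using M by (auto simp: Cr_map_def smooth_manifold_def comp_def)
  have "\<exists>A. has_chart_derivative c d (\<lambda>x. x) q A"
    if "c \<in> charts_at M q" "d \<in> charts_at M q" for q c d
    using Cr_map_has_chart_derivative[OF charts charts ident _ that] by auto
  with M show ?thesis
    by (simp add: differentiable_manifold_def smooth_manifold_def)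
qed

lemma Cr_map_imp_differentiable_map_at:
  assumes "differentiable_manifold M" "differentiable_manifold N"
    and f: "Cr_map r M N f" "1 \<le> r" and q: "q \<in> points M"
  shows "differentiable_map_at M N f q"
proof -
  have "f q \<in> points N"
    using f(1) q continuous_map_image_subset_topspace unfolding Cr_map_def by blast
  then show ?thesis
    using Cr_map_has_chart_derivative[OF _ _ f] assms
    unfolding differentiable_map_at_def differentiable_manifold_def by blast
qed


section \<open>Tangent maps\<close>

lemma tangent_spaceI:
  assumes M: "differentiable_manifold M"
    and "\<And>c. c \<notin> charts_at M q \<Longrightarrow> v c = 0"
    and v: "\<And>c d A. \<lbrakk>c \<in> charts_at M q; d \<in> charts_at M q; has_chart_derivative c d (\<lambda>x. x) q A\<rbrakk>
           \<Longrightarrow> v d = A (v c)"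
  shows "v \<in> tangent_space M q"
proof -
  have "v d = frechet_derivative (coord d \<circ> param c) (at (coord c q)) (v c)"
    if c_at: "c \<in> charts_at M q" and d_at: "d \<in> charts_at M q" for c d
  proof -
    obtain A where A_deriv: "has_chart_derivative c d (\<lambda>x. x) q A"
      using transition_has_chart_derivative[OF M c_at d_at] .
    then have "frechet_derivative (coord d \<circ> param c) (at (coord c q)) = A"
      using has_chart_derivative_frechet[OF A_deriv] by (simp add: comp_def)
    with v[OF c_at d_at A_deriv] show ?thesis by simp
  qed
  with assms(2) show ?thesis
    unfolding tangent_space_def by blast
qed

lemma tangent_space_outside: "v \<in> tangent_space M q \<Longrightarrow> c \<notin> charts_at M q \<Longrightarrow> v c = 0"
  unfolding tangent_space_def by blast

lemma tangent_space_transition: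
  assumes v: "v \<in> tangent_space M q" "c \<in> charts_at M q" "d \<in> charts_at M q"
    and A_deriv: "has_chart_derivative c d (\<lambda>x. x) q A"
  shows "v d = A (v c)"
proof -
  have "v d = frechet_derivative (coord d \<circ> param c) (at (coord c q)) (v c)"
    using v unfolding tangent_space_def by blast
  then show ?thesis
    using has_chart_derivative_frechet[OF A_deriv] by (simp add: comp_def)
qed

lemma tangent_map_outside: "d \<notin> charts_at N (f q) \<Longrightarrow> tangent_map M N f q v d = 0"
  by (simp add: tangent_map_def Let_def)

lemma tangent_map_chart:
  assumes M: "differentiable_manifold M" and v: "v \<in> tangent_space M q"
    and c_at: "c \<in> charts_at M q" and A_deriv: "has_chart_derivative c d f q A"
    and d_at: "d \<in> charts_at N (f q)"
  shows "tangent_map M N f q v d = A (v c)"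
proof -
  let ?c = "chart_at M q"
  have c'_at: "?c \<in> charts_at M q"
    by (rule chart_at_in_charts_at[OF M charts_atD(3)[OF M c_at]])
  obtain T where T_deriv: "has_chart_derivative ?c c (\<lambda>x. x) q T"
    using transition_has_chart_derivative[OF M c'_at c_at] .
  have "has_chart_derivative ?c d f q (\<lambda>w. A (T w))"
    by (rule has_chart_derivative_compose_at[OF M c'_at M c_at T_deriv A_deriv])
  then have "tangent_map M N f q v d = A (T (v ?c))"
    using d_at has_chart_derivative_frechet[of ?c d f q] by (simp add: tangent_map_def Let_def)
  then show ?thesis
    by (simp add: tangent_space_transition[OF v c'_at c_at T_deriv])
qed

lemma tangent_map_in_tangent_space:
  assumes M: "differentiable_manifold M" and N: "differentiable_manifold N"
    and f: "differentiable_map_at M N f q" and v: "v \<in> tangent_space M q"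
  shows "tangent_map M N f q v \<in> tangent_space N (f q)"
proof (rule tangent_spaceI[OF N tangent_map_outside])
  fix d e T
  assume d_at: "d \<in> charts_at N (f q)" and e_at: "e \<in> charts_at N (f q)"
    and T_deriv: "has_chart_derivative d e (\<lambda>y. y) (f q) T"
  have c_at: "chart_at M q \<in> charts_at M q"
    using f by (intro chart_at_in_charts_at[OF M]) (simp add: differentiable_map_at_def)
  obtain A where A_deriv: "has_chart_derivative (chart_at M q) d f q A"
    using differentiable_map_atE[OF f c_at d_at] .
  have "has_chart_derivative (chart_at M q) e f q (\<lambda>w. T (A w))"
    by (rule has_chart_derivative_compose_at[OF M c_at N d_at A_deriv T_deriv])
  from tangent_map_chart[OF M v c_at this e_at]
  show "tangent_map M N f q v e = T (tangent_map M N f q v d)"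
    by (simp add: tangent_map_chart[OF M v c_at A_deriv d_at])
qed

lemma tangent_map_compose:
  assumes M: "differentiable_manifold M" and N: "differentiable_manifold N"
    and f: "differentiable_map_at M N f q" and g: "differentiable_map_at N P g (f q)"
    and v: "v \<in> tangent_space M q"
  shows "tangent_map M P (\<lambda>x. g (f x)) q v = tangent_map N P g (f q) (tangent_map M N f q v)"
proof
  fix e
  show "tangent_map M P (\<lambda>x. g (f x)) q v e = tangent_map N P g (f q) (tangent_map M N f q v) e"
  proof (cases "e \<in> charts_at P (g (f q))")
    case e_at: True
    have c_at: "chart_at M q \<in> charts_at M q" and d_at: "chart_at N (f q) \<in> charts_at N (f q)"
      using f by (auto intro: chart_at_in_charts_at M N simp: differentiable_map_at_def)
    obtain A where A_deriv: "has_chart_derivative (chart_at M q) (chart_at N (f q)) f q A"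
      using differentiable_map_atE[OF f c_at d_at] .
    obtain B where B_deriv: "has_chart_derivative (chart_at N (f q)) e g (f q) B"
      using differentiable_map_atE[OF g d_at e_at] .
    have "has_chart_derivative (chart_at M q) e (\<lambda>x. g (f x)) q (\<lambda>w. B (A w))"
      by (rule has_chart_derivative_compose_at[OF M c_at N d_at A_deriv B_deriv])
    from tangent_map_chart[OF M v c_at this e_at] show ?thesis
      by (simp add: tangent_map_chart[OF M v c_at A_deriv d_at]
          tangent_map_chart[OF N tangent_map_in_tangent_space[OF M N f v] d_at B_deriv e_at])
  qed (simp add: tangent_map_outside)
qed

lemma tangent_map_transform:
  assumes M: "differentiable_manifold M" and f: "differentiable_map_at M N f q"
    and f_eq_g: "\<And>x. x \<in> points M \<Longrightarrow> f x = g x" and v: "v \<in> tangent_space M q"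
  shows "tangent_map M N f q v = tangent_map M N g q v"
proof
  fix d
  have q: "q \<in> points M"
    using f by (simp add: differentiable_map_at_def)
  then have c_at: "chart_at M q \<in> charts_at M q"
    by (rule chart_at_in_charts_at[OF M])
  show "tangent_map M N f q v d = tangent_map M N g q v d"
  proof (cases "d \<in> charts_at N (f q)")
    case d_at: True
    obtain A where A_deriv: "has_chart_derivative (chart_at M q) d f q A"
      using differentiable_map_atE[OF f c_at d_at] .
    have "has_chart_derivative (chart_at M q) d g q A"
      using has_chart_derivative_transform_points[OF M c_at A_deriv f_eq_g] .
    from tangent_map_chart[OF M v c_at this] show ?thesis
      using d_at by (simp add: tangent_map_chart[OF M v c_at A_deriv d_at] f_eq_g[OF q])
  qed (simp add: tangent_map_outside f_eq_g[OF q])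
qed

lemma tscale_in_tangent_space:
  assumes M: "differentiable_manifold M" and v: "v \<in> tangent_space M q"
  shows "tscale a v \<in> tangent_space M q"
proof (rule tangent_spaceI[OF M])
  show "tscale a v c = 0" if "c \<notin> charts_at M q" for c
    using tangent_space_outside[OF v that] by (simp add: tscale_def)
  show "tscale a v d = A (tscale a v c)"
    if "c \<in> charts_at M q" "d \<in> charts_at M q" "has_chart_derivative c d (\<lambda>x. x) q A" for c d A
    using tangent_space_transition[OF v that]
      linear_cmul[OF has_chart_derivative_linear[OF that(3)]]
    by (simp add: tscale_def)
qed

lemma tangent_map_tscale:
  assumes M: "differentiable_manifold M" and f: "differentiable_map_at M N f q"
    and v: "v \<in> tangent_space M q"
  shows "tangent_map M N f q (tscale a v) = tscale a (tangent_map M N f q v)"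
proof
  fix d
  show "tangent_map M N f q (tscale a v) d = tscale a (tangent_map M N f q v) d"
  proof (cases "d \<in> charts_at N (f q)")
    case d_at: True
    have c_at: "chart_at M q \<in> charts_at M q"
      using f by (intro chart_at_in_charts_at[OF M]) (simp add: differentiable_map_at_def)
    obtain A where A_deriv: "has_chart_derivative (chart_at M q) d f q A"
      using differentiable_map_atE[OF f c_at d_at] .
    show ?thesis
      using tangent_map_chart[OF M v c_at A_deriv d_at]
        tangent_map_chart[OF M tscale_in_tangent_space[OF M v] c_at A_deriv d_at]
        linear_cmul[OF has_chart_derivative_linear[OF A_deriv]]
      by (simp add: tscale_def)
  qed (simp add: tangent_map_outside tscale_def)
qed

lemma tangent_map_prod_split:
  assumes M: "differentiable_manifold M" and N: "differentiable_manifold N"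
    and f: "differentiable_map_at (prod_mfd M N) P f (x, y)"
    and w: "w \<in> tangent_space (prod_mfd M N) (x, y)" and e_at: "e \<in> charts_at P (f (x, y))"
  shows "tangent_map (prod_mfd M N) P f (x, y) w e =
    tangent_map M P (\<lambda>x. f (x, y)) x (tangent_map (prod_mfd M N) M fst (x, y) w) e +
    tangent_map N P (\<lambda>y. f (x, y)) y (tangent_map (prod_mfd M N) N snd (x, y) w) e"
proof -
  let ?MN = "prod_mfd M N" and ?c = "chart_at M x" and ?d = "chart_at N y"
  let ?w = "w (prod_chart ?c ?d)"
  note MN = differentiable_manifold_prod[OF M N]
  have xy: "(x, y) \<in> points ?MN"
    using f by (simp add: differentiable_map_at_def)
  then have c_at: "?c \<in> charts_at M x" and d_at: "?d \<in> charts_at N y"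
    by (auto simp: points_prod intro: chart_at_in_charts_at M N)
  then have cd_at: "prod_chart ?c ?d \<in> charts_at ?MN (x, y)"
    by (intro prod_chart_in_charts_at) simp_all
  note c_chart = charts_atD(1,2)[OF M c_at] and d_chart = charts_atD(1,2)[OF N d_at]
  obtain B where B_deriv: "has_chart_derivative (prod_chart ?c ?d) e f (x, y) B"
    using differentiable_map_atE[OF f cd_at e_at] .
  have "tangent_map M P (\<lambda>x. f (x, y)) x (tangent_map ?MN M fst (x, y) w) e = B (fst ?w, 0)"
  proof -
    have "tangent_map ?MN M fst (x, y) w \<in> tangent_space M x"
      using tangent_map_in_tangent_space[OF MN M differentiable_map_at_fst[OF M N xy] w] by simp
    from tangent_map_chart
      [OF M this c_at has_chart_derivative_partial_fst[OF c_chart d_chart B_deriv]]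
    show ?thesis
      using tangent_map_chart[OF MN w cd_at has_chart_derivative_fst[OF c_chart(1) d_chart(1)]]
        c_at e_at c_chart d_chart
      by simp
  qed
  moreover
  have "tangent_map N P (\<lambda>y. f (x, y)) y (tangent_map ?MN N snd (x, y) w) e = B (0, snd ?w)"
  proof -
    have "tangent_map ?MN N snd (x, y) w \<in> tangent_space N y"
      using tangent_map_in_tangent_space[OF MN N differentiable_map_at_snd[OF M N xy] w] by simp
    from tangent_map_chart
      [OF N this d_at has_chart_derivative_partial_snd[OF c_chart d_chart B_deriv]]
    show ?thesis
      using tangent_map_chart[OF MN w cd_at has_chart_derivative_snd[OF c_chart(1) d_chart(1)]]
        d_at e_at c_chart d_chart
      by simp
  qed
  moreover have "tangent_map ?MN P f (x, y) w e = B ?w"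
    by (rule tangent_map_chart[OF MN w cd_at B_deriv e_at])
  ultimately show ?thesis
    using linear_add[OF has_chart_derivative_linear[OF B_deriv], of "(fst ?w, 0)" "(0, snd ?w)"]
    by simp
qed

lemma differential_eq_tangent_map:
  "differential M f q v = tangent_map M euclidean_mfd f q v id_chart"
  by (simp add: differential_def tangent_map_def charts_at_euclidean Let_def)


section \<open>Velocities of curves\<close>

definition has_velocity ::
  "('a, 'e::euclidean_space) mfd \<Rightarrow> (real \<Rightarrow> 'a) \<Rightarrow> real \<Rightarrow> ('a, 'e) tvec \<Rightarrow> bool" where
  "has_velocity M \<gamma> s v \<longleftrightarrow>
     \<gamma> s \<in> points M \<and> (\<forall>d. d \<notin> charts_at M (\<gamma> s) \<longrightarrow> v d = 0) \<and>
     (\<forall>d\<in>charts_at M (\<gamma> s). has_chart_derivative id_chart d \<gamma> s (\<lambda>h. h *\<^sub>R v d))"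

lemma has_velocity_in_points: "has_velocity M \<gamma> s v \<Longrightarrow> \<gamma> s \<in> points M"
  by (simp add: has_velocity_def)

lemma has_velocity_outside: "has_velocity M \<gamma> s v \<Longrightarrow> d \<notin> charts_at M (\<gamma> s) \<Longrightarrow> v d = 0"
  unfolding has_velocity_def by blast

lemma has_velocity_has_chart_derivative:
  "has_velocity M \<gamma> s v \<Longrightarrow> d \<in> charts_at M (\<gamma> s) \<Longrightarrow>
     has_chart_derivative id_chart d \<gamma> s (\<lambda>h. h *\<^sub>R v d)"
  by (simp add: has_velocity_def)

lemma has_chart_derivative_id_chart_iff:
  "has_chart_derivative id_chart d \<gamma> s (\<lambda>h. h *\<^sub>R v) \<longleftrightarrow>
     (\<forall>\<^sub>F s' in nhds s. \<gamma> s' \<in> dom_of d) \<and> ((\<lambda>s. coord d (\<gamma> s)) has_vector_derivative v) (at s)"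
  by (simp add: has_chart_derivative_def has_vector_derivative_def param_id_chart comp_def)

lemma has_chart_derivative_compose_curve:
  assumes M: "differentiable_manifold M" and c_at: "c \<in> charts_at M (\<gamma> s)"
    and \<gamma>: "has_chart_derivative id_chart c \<gamma> s (\<lambda>h. h *\<^sub>R v)"
    and f: "has_chart_derivative c d f (\<gamma> s) A"
  shows "has_chart_derivative id_chart d (\<lambda>s. f (\<gamma> s)) s (\<lambda>h. h *\<^sub>R A v)"
proof -
  have "has_chart_derivative id_chart d (\<lambda>s. f (\<gamma> s)) s (\<lambda>h. A (h *\<^sub>R v))"
    by (rule has_chart_derivative_compose
        [OF is_chart_euclidean _ charts_atD(1)[OF M c_at] \<gamma> f]) simp
  then show ?thesis
    by (simp add: linear_cmul[OF has_chart_derivative_linear[OF f]])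
qed

lemma has_velocity_coord:
  assumes "has_velocity M \<gamma> s v" "d \<in> charts_at M (\<gamma> s)"
  shows "\<forall>\<^sub>F s' in nhds s. \<gamma> s' \<in> dom_of d" "((\<lambda>s. coord d (\<gamma> s)) has_vector_derivative v d) (at s)"
  using has_velocity_has_chart_derivative[OF assms]
  unfolding has_chart_derivative_id_chart_iff by blast+

lemma has_velocity_imp_velocity:
  assumes "has_velocity M \<gamma> s v"
  shows "velocity M \<gamma> s = v"
proof
  fix d
  show "velocity M \<gamma> s d = v d"
    using has_velocity_outside[OF assms, of d]
      vector_derivative_at[OF has_velocity_coord(2)[OF assms, of d]]
    by (simp add: velocity_def comp_def)
qed

lemma has_velocity_in_tangent_space:
  assumes M: "differentiable_manifold M" and v: "has_velocity M \<gamma> s v"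
  shows "v \<in> tangent_space M (\<gamma> s)"
proof (rule tangent_spaceI[OF M])
  show "v c = 0" if "c \<notin> charts_at M (\<gamma> s)" for c
    using has_velocity_outside[OF v that] .
next
  fix c d A
  assume c_at: "c \<in> charts_at M (\<gamma> s)" and d_at: "d \<in> charts_at M (\<gamma> s)"
    and A_deriv: "has_chart_derivative c d (\<lambda>x. x) (\<gamma> s) A"
  have "has_chart_derivative id_chart d \<gamma> s (\<lambda>h. h *\<^sub>R A (v c))"
    by (rule has_chart_derivative_compose_curve
        [OF M c_at has_velocity_has_chart_derivative[OF v c_at] A_deriv])
  from has_chart_derivative_unique[OF has_velocity_has_chart_derivative[OF v d_at] this]
  have "1 *\<^sub>R v d = 1 *\<^sub>R A (v c)"
    by (rule fun_cong)
  then show "v d = A (v c)"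
    by simp
qed

lemma has_velocity_chartI:
  assumes M: "differentiable_manifold M" and v: "v \<in> tangent_space M (\<gamma> s)"
    and c_at: "c \<in> charts_at M (\<gamma> s)" and \<gamma>: "has_chart_derivative id_chart c \<gamma> s (\<lambda>h. h *\<^sub>R v c)"
  shows "has_velocity M \<gamma> s v"
  unfolding has_velocity_def
proof (intro conjI ballI allI impI)
  fix d assume d_at: "d \<in> charts_at M (\<gamma> s)"
  obtain A where A_deriv: "has_chart_derivative c d (\<lambda>x. x) (\<gamma> s) A"
    using transition_has_chart_derivative[OF M c_at d_at] .
  from has_chart_derivative_compose_curve[OF M c_at \<gamma> A_deriv]
  show "has_chart_derivative id_chart d \<gamma> s (\<lambda>h. h *\<^sub>R v d)"
    by (simp add: tangent_space_transition[OF v c_at d_at A_deriv])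
qed (use charts_atD(3)[OF M c_at] tangent_space_outside[OF v] in auto)

lemma has_velocity_compose:
  assumes M: "differentiable_manifold M" and N: "differentiable_manifold N"
    and v: "has_velocity M \<gamma> s v" and f: "differentiable_map_at M N f (\<gamma> s)"
  shows "has_velocity N (\<lambda>s. f (\<gamma> s)) s (tangent_map M N f (\<gamma> s) v)"
proof -
  note v_tangent = has_velocity_in_tangent_space[OF M v]
  have c_at: "chart_at M (\<gamma> s) \<in> charts_at M (\<gamma> s)"
    and d_at: "chart_at N (f (\<gamma> s)) \<in> charts_at N (f (\<gamma> s))"
    using f by (auto intro: chart_at_in_charts_at M N simp: differentiable_map_at_def)
  obtain A where A_deriv: "has_chart_derivative (chart_at M (\<gamma> s)) (chart_at N (f (\<gamma> s))) f (\<gamma> s) A"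
    using differentiable_map_atE[OF f c_at d_at] .
  from has_chart_derivative_compose_curve
    [OF M c_at has_velocity_has_chart_derivative[OF v c_at] A_deriv]
  have "has_chart_derivative id_chart (chart_at N (f (\<gamma> s))) (\<lambda>s. f (\<gamma> s)) s
      (\<lambda>h. h *\<^sub>R tangent_map M N f (\<gamma> s) v (chart_at N (f (\<gamma> s))))"
    by (simp add: tangent_map_chart[OF M v_tangent c_at A_deriv d_at])
  from has_velocity_chartI[where \<gamma>="\<lambda>s. f (\<gamma> s)",
      OF N tangent_map_in_tangent_space[OF M N f v_tangent] d_at this]
  show ?thesis .
qed

lemma has_velocity_transform:
  assumes \<gamma>: "has_velocity M \<gamma> s v" and eventually_eq: "\<forall>\<^sub>F s' in nhds s. \<gamma> s' = \<delta> s'"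
  shows "has_velocity M \<delta> s v"
proof -
  have "has_chart_derivative id_chart d \<delta> s (\<lambda>h. h *\<^sub>R v d)" if "d \<in> charts_at M (\<gamma> s)" for d
    using has_velocity_has_chart_derivative[OF \<gamma> that]
    by (rule has_chart_derivative_transform) (use eventually_eq in \<open>simp add: param_id_chart\<close>)
  then show ?thesis
    using \<gamma> eventually_nhds_x_imp_x[OF eventually_eq] by (simp add: has_velocity_def)
qed

lemma has_velocity_affine:
  assumes \<gamma>: "has_velocity M \<gamma> (a * s + b) v"
  shows "has_velocity M (\<lambda>s. \<gamma> (a * s + b)) s (tscale a v)"
  unfolding has_velocity_def
proof (intro conjI ballI allI impI)
  show "\<gamma> (a * s + b) \<in> points M"
    using has_velocity_in_points[OF \<gamma>] .
  show "tscale a v d = 0" if "d \<notin> charts_at M (\<gamma> (a * s + b))" for d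
    using has_velocity_outside[OF \<gamma> that] by (simp add: tscale_def)
  fix d assume d_at: "d \<in> charts_at M (\<gamma> (a * s + b))"
  have "((\<lambda>s. a * s + b) has_vector_derivative a) (at s)"
    by (auto intro!: derivative_eq_intros)
  then have "has_chart_derivative id_chart id_chart (\<lambda>s. a * s + b) s (\<lambda>h. h *\<^sub>R a)"
    unfolding has_chart_derivative_id_chart_iff by (simp add: comp_def)
  from has_chart_derivative_compose[OF is_chart_euclidean _ is_chart_euclidean this
      has_velocity_has_chart_derivative[OF \<gamma> d_at]]
  show "has_chart_derivative id_chart d (\<lambda>s. \<gamma> (a * s + b)) s (\<lambda>h. h *\<^sub>R tscale a v d)"
    by (simp add: tscale_def)
qed

lemma open_iff_eventually_nhds:
  fixes S :: "'a::topological_space set"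
  shows "open S \<longleftrightarrow> (\<forall>x\<in>S. \<forall>\<^sub>F y in nhds x. y \<in> S)"
proof
  assume S: "\<forall>x\<in>S. \<forall>\<^sub>F y in nhds x. y \<in> S"
  show "open S"
  proof (rule Topological_Spaces.openI)
    fix x assume "x \<in> S"
    with S obtain T where "open T" "x \<in> T" "\<forall>y\<in>T. y \<in> S"
      unfolding eventually_nhds by meson
    then show "\<exists>T. open T \<and> x \<in> T \<and> T \<subseteq> S"
      by (intro exI[of _ T]) auto
  qed
qed (simp add: eventually_nhds_in_open)

lemma has_velocity_eventually_in:
  assumes M: "differentiable_manifold M" and \<gamma>: "has_velocity M \<gamma> s v"
    and U: "openin (mfd_top M) U" "\<gamma> s \<in> U"
  shows "\<forall>\<^sub>F s' in nhds s. \<gamma> s' \<in> U"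
proof -
  let ?d = "chart_at M (\<gamma> s)"
  have d_at: "?d \<in> charts_at M (\<gamma> s)"
    by (rule chart_at_in_charts_at[OF M has_velocity_in_points[OF \<gamma>]])
  note d_chart = charts_atD[OF M d_at]
  have "((\<lambda>s. coord ?d (\<gamma> s)) \<longlongrightarrow> coord ?d (\<gamma> s)) (nhds s)"
    using has_velocity_coord(2)[OF \<gamma> d_at] unfolding has_vector_derivative_def
    by (rule has_derivative_imp_tendsto_nhds)
  with is_chart_eventually_in[OF d_chart(1,2) U]
  have "\<forall>\<^sub>F s' in nhds s. coord ?d (\<gamma> s') \<in> coord ?d ` (dom_of ?d \<inter> U)"
    by (rule eventually_compose_filterlim)
  with has_velocity_coord(1)[OF \<gamma> d_at] show ?thesis
    by eventually_elim (use is_chart_inj_on[OF d_chart(1)] in \<open>auto dest: inj_onD\<close>)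
qed

lemma differentiable_curve_has_velocity:
  assumes M: "differentiable_manifold M" and \<gamma>: "differentiable_curve M \<gamma>"
  shows "has_velocity M \<gamma> s (velocity M \<gamma> s)"
  unfolding has_velocity_def has_chart_derivative_id_chart_iff
proof (intro allI conjI ballI impI)
  have cont: "continuous_map euclidean (mfd_top M) \<gamma>"
    using \<gamma> by (simp add: differentiable_curve_def)
  show "\<gamma> s \<in> points M"
    using continuous_map_image_subset_topspace[OF cont] by auto
  show "velocity M \<gamma> s d = 0" if "d \<notin> charts_at M (\<gamma> s)" for d
    using that by (simp add: velocity_def)
  fix d assume d_at: "d \<in> charts_at M (\<gamma> s)"
  have "openin (mfd_top M) (dom_of d)"
    using charts_atD(1)[OF M d_at] by (simp add: is_chart_def)
  then have "open {s. \<gamma> s \<in> dom_of d}"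
    using openin_continuous_map_preimage[OF cont] by fastforce
  then show "\<forall>\<^sub>F s in nhds s. \<gamma> s \<in> dom_of d"
    using eventually_nhds_in_open charts_atD(2)[OF M d_at] by fastforce
  show "((\<lambda>s. coord d (\<gamma> s)) has_vector_derivative velocity M \<gamma> s d) (at s)"
    using \<gamma> d_at
    by (simp add: differentiable_curve_def velocity_def vector_derivative_works comp_def)
qed

lemma differentiable_curveI:
  assumes M: "differentiable_manifold M" and \<gamma>: "\<And>s. has_velocity M \<gamma> s (v s)"
  shows "differentiable_curve M \<gamma>"
  unfolding differentiable_curve_def continuous_map_def
proof (intro conjI allI impI ballI)
  show "\<gamma> \<in> topspace euclidean \<rightarrow> points M"
    using has_velocity_in_points[OF \<gamma>] by simp
  show "openin euclidean {s \<in> topspace euclidean. \<gamma> s \<in> U}" if "openin (mfd_top M) U" for U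
    using has_velocity_eventually_in[OF M \<gamma> that] by (simp add: open_iff_eventually_nhds)
  show "(coord d \<circ> \<gamma>) differentiable (at s)" if "d \<in> charts_at M (\<gamma> s)" for s d
    using has_velocity_coord(2)[OF \<gamma> that] by (auto simp: comp_def intro: differentiableI_vector)
qed


section \<open>Integral curves of vector fields\<close>

definition integral_curve_at ::
  "('a, 'e::euclidean_space) mfd \<Rightarrow> ('a \<Rightarrow> ('a, 'e) tvec) \<Rightarrow> (real \<Rightarrow> 'a) \<Rightarrow> real \<Rightarrow> bool" where
  "integral_curve_at M X \<gamma> s \<longleftrightarrow> has_velocity M \<gamma> s (X (\<gamma> s))"

lemma integral_curve_at_in_points: "integral_curve_at M X \<gamma> s \<Longrightarrow> \<gamma> s \<in> points M"
  unfolding integral_curve_at_def by (rule has_velocity_in_points)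

lemma integral_curve_iff:
  assumes M: "differentiable_manifold M"
  shows "integral_curve M X \<gamma> \<longleftrightarrow> (\<forall>s. integral_curve_at M X \<gamma> s)"
proof
  assume "integral_curve M X \<gamma>"
  then show "\<forall>s. integral_curve_at M X \<gamma> s"
    using differentiable_curve_has_velocity[OF M, of \<gamma>]
    by (simp add: integral_curve_def integral_curve_at_def)
next
  assume "\<forall>s. integral_curve_at M X \<gamma> s"
  then show "integral_curve M X \<gamma>"
    using differentiable_curveI[OF M, of \<gamma> "\<lambda>s. X (\<gamma> s)"]
      has_velocity_imp_velocity[of M \<gamma> _ "X (\<gamma> _)"]
    by (simp add: integral_curve_def integral_curve_at_def)
qed

lemma integral_curve_at_transform:
  assumes "integral_curve_at M X \<gamma> s" "\<forall>\<^sub>F s' in nhds s. \<gamma> s' = \<delta> s'"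
  shows "integral_curve_at M X \<delta> s"
  using assms has_velocity_transform eventually_nhds_x_imp_x[OF assms(2)]
  unfolding integral_curve_at_def by metis

lemma integral_curve_at_shift:
  assumes "integral_curve_at M X \<gamma> (s - b)"
  shows "integral_curve_at M X (\<lambda>s. \<gamma> (s - b)) s"
  using has_velocity_affine[of M \<gamma> 1 s "- b"] assms by (simp add: integral_curve_at_def tscale_def)

lemma integral_curve_at_rescale:
  assumes "integral_curve_at M X \<gamma> (a * s)" "Y (\<gamma> (a * s)) = tscale a (X (\<gamma> (a * s)))"
  shows "integral_curve_at M Y (\<lambda>s. \<gamma> (a * s)) s"
  using has_velocity_affine[of M \<gamma> a s 0] assms by (simp add: integral_curve_at_def)

definition locally_lipschitz_field ::
  "('a, 'e::euclidean_space) mfd \<Rightarrow> ('a \<Rightarrow> ('a, 'e) tvec) \<Rightarrow> bool" where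
  "locally_lipschitz_field M X \<longleftrightarrow>
     (\<forall>q\<in>points M. X q \<in> tangent_space M q) \<and>
     (\<forall>d\<in>atlas M. local_lipschitz (UNIV :: real set) (coord d ` dom_of d) (\<lambda>_ y. X (param d y) d))"

lemma locally_lipschitz_field_cballE:
  assumes M: "differentiable_manifold M" and X: "locally_lipschitz_field M X"
    and d_at: "d \<in> charts_at M q"
  obtains r L where "r > 0" "cball (coord d q) r \<subseteq> coord d ` dom_of d"
    "L-lipschitz_on (cball (coord d q) r) (\<lambda>y. X (param d y) d)"
proof (rule local_lipschitz_cballE)
  show "local_lipschitz (UNIV :: real set) (coord d ` dom_of d) (\<lambda>_ y. X (param d y) d)"
    using X d_at by (simp add: locally_lipschitz_field_def charts_at_def)
  show "open (coord d ` dom_of d)" "coord d q \<in> coord d ` dom_of d"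
    using charts_atD[OF M d_at] by (auto simp: is_chart_def)
qed (use that in auto)

lemma integral_curve_at_param:
  assumes M: "differentiable_manifold M" and X: "\<And>q. q \<in> points M \<Longrightarrow> X q \<in> tangent_space M q"
    and c_atlas: "c \<in> atlas M" and "u s \<in> coord c ` dom_of c"
    and u: "(u has_vector_derivative X (param c (u s)) c) (at s)"
  shows "integral_curve_at M X (\<lambda>s. param c (u s)) s"
proof -
  have c_chart: "is_chart (mfd_top M) c" "open (coord c ` dom_of c)"
    using M c_atlas by (auto simp: differentiable_manifold_def is_chart_def)
  have u_deriv: "(u has_derivative (\<lambda>h. h *\<^sub>R X (param c (u s)) c)) (at s)"
    using u by (simp add: has_vector_derivative_def)
  have "\<forall>\<^sub>F s' in nhds s. u s' \<in> coord c ` dom_of c"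
    by (rule eventually_compose_filterlim
        [OF eventually_nhds_in_open[OF c_chart(2)]
          has_derivative_imp_tendsto_nhds[OF u_deriv]]) fact
  then have near: "\<forall>\<^sub>F s' in nhds s. param c (u s') \<in> dom_of c \<and> coord c (param c (u s')) = u s'"
    by eventually_elim (use param_coord[OF c_chart(1)] in auto)
  then have c_at: "c \<in> charts_at M (param c (u s))"
    using eventually_nhds_x_imp_x c_atlas by (fastforce simp: charts_at_def)
  have "\<forall>\<^sub>F s' in nhds s. u s' = coord c (param c (u s'))"
    using near by eventually_elim simp
  from has_derivative_transform_nhds[OF u_deriv this]
  have "((\<lambda>s. coord c (param c (u s))) has_vector_derivative X (param c (u s)) c) (at s)"
    by (simp add: has_vector_derivative_def)
  moreover have "\<forall>\<^sub>F s' in nhds s. param c (u s') \<in> dom_of c"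
    using near by eventually_elim simp
  ultimately
  have "has_chart_derivative id_chart c (\<lambda>s. param c (u s)) s (\<lambda>h. h *\<^sub>R X (param c (u s)) c)"
    by (simp add: has_chart_derivative_id_chart_iff)
  then show ?thesis
    unfolding integral_curve_at_def
    by (intro has_velocity_chartI[where \<gamma>="\<lambda>s. param c (u s)",
          OF M X[OF charts_atD(3)[OF M c_at]] c_at])
qed

lemma integral_curve_local_existence:
  assumes M: "differentiable_manifold M" and X: "locally_lipschitz_field M X" and q: "q \<in> points M"
  obtains \<epsilon> \<sigma> where "\<epsilon> > 0" "\<sigma> 0 = q" "\<forall>s. \<bar>s\<bar> < \<epsilon> \<longrightarrow> integral_curve_at M X \<sigma> s"
proof -
  let ?c = "chart_at M q"
  have c_at: "?c \<in> charts_at M q"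
    by (rule chart_at_in_charts_at[OF M q])
  then have c_atlas: "?c \<in> atlas M"
    by (simp add: charts_at_def)
  obtain r L where r: "r > 0" "cball (coord ?c q) r \<subseteq> coord ?c ` dom_of ?c"
    and L: "L-lipschitz_on (cball (coord ?c q) r) (\<lambda>y. X (param ?c y) ?c)"
    using locally_lipschitz_field_cballE[OF M X c_at] .
  obtain \<epsilon> u where "\<epsilon> > 0" "u 0 = coord ?c q"
    and u: "\<forall>s. \<bar>s\<bar> < \<epsilon> \<longrightarrow> u s \<in> cball (coord ?c q) r \<and>
      (u has_vector_derivative X (param ?c (u s)) ?c) (at s)"
    using ode_local_existence[OF r(1) L] .
  show ?thesis
  proof (rule that[OF \<open>\<epsilon> > 0\<close>, of "\<lambda>s. param ?c (u s)"])
    show "param ?c (u 0) = q"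
      using \<open>u 0 = _\<close> param_coord[OF charts_atD(1,2)[OF M c_at]] by simp
    show "\<forall>s. \<bar>s\<bar> < \<epsilon> \<longrightarrow> integral_curve_at M X (\<lambda>s. param ?c (u s)) s"
    proof (intro allI impI integral_curve_at_param[OF M _ c_atlas])
      show "X p \<in> tangent_space M p" if "p \<in> points M" for p
        using X that by (simp add: locally_lipschitz_field_def)
    qed (use u r(2) in auto)
  qed
qed

lemma integral_curve_at_coord:
  assumes M: "differentiable_manifold M" and \<gamma>: "\<forall>\<^sub>F s in nhds s0. integral_curve_at M X \<gamma> s"
    and d_at: "d \<in> charts_at M (\<gamma> s0)" and "r > 0"
  shows "\<forall>\<^sub>F s in nhds s0. \<gamma> s \<in> dom_of d \<and> coord d (\<gamma> s) \<in> cball (coord d (\<gamma> s0)) r \<and>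
    ((\<lambda>s. coord d (\<gamma> s)) has_vector_derivative X (param d (coord d (\<gamma> s))) d) (at s)"
proof -
  have "has_velocity M \<gamma> s0 (X (\<gamma> s0))"
    using eventually_nhds_x_imp_x[OF \<gamma>] by (simp add: integral_curve_at_def)
  note v = has_velocity_coord[OF this d_at]
  have "\<forall>\<^sub>F y in nhds (coord d (\<gamma> s0)). y \<in> ball (coord d (\<gamma> s0)) r"
    using \<open>r > 0\<close> by (intro eventually_nhds_in_open) auto
  moreover have "((\<lambda>s. coord d (\<gamma> s)) \<longlongrightarrow> coord d (\<gamma> s0)) (nhds s0)"
    using v(2) unfolding has_vector_derivative_def by (rule has_derivative_imp_tendsto_nhds)
  ultimately have "\<forall>\<^sub>F s in nhds s0. coord d (\<gamma> s) \<in> ball (coord d (\<gamma> s0)) r"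
    by (rule eventually_compose_filterlim)
  with v(1) \<gamma> show ?thesis
  proof eventually_elim
    case (elim s)
    have "d \<in> charts_at M (\<gamma> s)"
      using d_at elim(1) by (rule charts_at_dom_of)
    from has_velocity_coord(2)[OF elim(2)[unfolded integral_curve_at_def] this] show ?case
      using elim param_coord[OF charts_atD(1)[OF M d_at] elim(1)] by simp
  qed
qed

lemma integral_curve_local_uniqueness:
  assumes M: "differentiable_manifold M" and X: "locally_lipschitz_field M X"
    and \<gamma>: "\<forall>\<^sub>F s in nhds s0. integral_curve_at M X \<gamma> s"
    and \<delta>: "\<forall>\<^sub>F s in nhds s0. integral_curve_at M X \<delta> s"
    and initial: "\<gamma> s0 = \<delta> s0"
  shows "\<forall>\<^sub>F s in nhds s0. \<gamma> s = \<delta> s"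
proof -
  let ?d = "chart_at M (\<gamma> s0)"
  have d_at: "?d \<in> charts_at M (\<gamma> s0)"
    using eventually_nhds_x_imp_x[OF \<gamma>]
    by (intro chart_at_in_charts_at[OF M]) (rule integral_curve_at_in_points)
  obtain r L where "r > 0"
    and L: "L-lipschitz_on (cball (coord ?d (\<gamma> s0)) r) (\<lambda>y. X (param ?d y) ?d)"
    using locally_lipschitz_field_cballE[OF M X d_at] .
  note u = integral_curve_at_coord[OF M \<gamma> d_at \<open>r > 0\<close>]
    and v = integral_curve_at_coord[OF M \<delta> d_at[unfolded initial] \<open>r > 0\<close>, folded initial]
  have "\<forall>\<^sub>F s in nhds s0. coord ?d (\<gamma> s) = coord ?d (\<delta> s)"
    by (rule ode_local_uniqueness[OF L eventually_mono[OF u] eventually_mono[OF v]])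
      (use initial in auto)
  with u v show ?thesis
    by eventually_elim (use is_chart_inj_on[OF charts_atD(1)[OF M d_at]] in \<open>auto dest: inj_onD\<close>)
qed

lemma integral_curve_unique:
  assumes M: "differentiable_manifold M" and Hausdorff: "Hausdorff_space (mfd_top M)"
    and X: "locally_lipschitz_field M X"
    and I: "open I" "connected I" "s0 \<in> I" "s \<in> I"
    and \<gamma>: "\<And>s. s \<in> I \<Longrightarrow> integral_curve_at M X \<gamma> s"
    and \<delta>: "\<And>s. s \<in> I \<Longrightarrow> integral_curve_at M X \<delta> s"
    and initial: "\<gamma> s0 = \<delta> s0"
  shows "\<gamma> s = \<delta> s"
proof -
  let ?A = "{s \<in> I. \<gamma> s = \<delta> s}" and ?B = "{s \<in> I. \<gamma> s \<noteq> \<delta> s}"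
  have near: "\<forall>\<^sub>F s' in nhds s. s' \<in> I" if "s \<in> I" for s
    using I(1) that by (rule eventually_nhds_in_open)
  have "open ?A"
    unfolding open_iff_eventually_nhds
  proof
    fix s assume s: "s \<in> ?A"
    then have "\<forall>\<^sub>F s' in nhds s. integral_curve_at M X \<gamma> s'"
      "\<forall>\<^sub>F s' in nhds s. integral_curve_at M X \<delta> s'"
      using near[of s] \<gamma> \<delta> by (auto elim!: eventually_mono)
    then have "\<forall>\<^sub>F s' in nhds s. \<gamma> s' = \<delta> s'"
      by (rule integral_curve_local_uniqueness[OF M X]) (use s in simp)
    with near[of s] s show "\<forall>\<^sub>F s' in nhds s. s' \<in> ?A"
      by (auto elim: eventually_elim2)
  qed
  moreover have "open ?B"
    unfolding open_iff_eventually_nhds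
  proof
    fix s assume s: "s \<in> ?B"
    then have v: "has_velocity M \<gamma> s (X (\<gamma> s))" "has_velocity M \<delta> s (X (\<delta> s))"
      using \<gamma> \<delta> by (auto simp: integral_curve_at_def)
    moreover have "\<gamma> s \<in> points M" "\<delta> s \<in> points M"
      using v by (auto dest: has_velocity_in_points)
    ultimately obtain U V where separated: "openin (mfd_top M) U" "openin (mfd_top M) V"
        "\<gamma> s \<in> U" "\<delta> s \<in> V" "disjnt U V"
      using Hausdorff[unfolded Hausdorff_space_def, rule_format, of "\<gamma> s" "\<delta> s"] s by auto
    have "\<forall>\<^sub>F s' in nhds s. s' \<in> I"
      using s near by blast
    with has_velocity_eventually_in[OF M v(1) separated(1,3)]
      has_velocity_eventually_in[OF M v(2) separated(2,4)]
    show "\<forall>\<^sub>F s' in nhds s. s' \<in> ?B"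
      by eventually_elim (use separated(5) in \<open>auto simp: disjnt_iff\<close>)
  qed
  ultimately have "?A \<inter> I = {} \<or> ?B \<inter> I = {}"
    by (intro connectedD[OF I(2)]) auto
  then show ?thesis
    using I initial by auto
qed

lemma integral_curve_at_glue:
  fixes p :: "int \<Rightarrow> real \<Rightarrow> 'a" and M :: "('a, 'e::euclidean_space) mfd"
  assumes M: "differentiable_manifold M" "Hausdorff_space (mfd_top M)"
    and X: "locally_lipschitz_field M X"
    and "\<epsilon> > 0"
    and pieces: "\<And>k s. \<bar>s - of_int k * \<epsilon>\<bar> < 2 * \<epsilon> \<Longrightarrow> integral_curve_at M X (p k) s"
    and meet: "\<And>k. p (k - 1) (of_int k * \<epsilon>) = p k (of_int k * \<epsilon>)"
  shows "integral_curve_at M X (\<lambda>s. p \<lfloor>s / \<epsilon>\<rfloor> s) s"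
proof -
  define k where "k = \<lfloor>s / \<epsilon>\<rfloor>"
  let ?I = "{of_int (k - 1) * \<epsilon><..<of_int (k + 1) * \<epsilon>}"
  have k_bounds: "of_int k * \<epsilon> \<le> s" "s < of_int (k + 1) * \<epsilon>"
    using \<open>\<epsilon> > 0\<close> floor_divide_lower[of \<epsilon> s] floor_divide_upper[of \<epsilon> s] by (auto simp: k_def)
  have overlap: "p (k - 1) s' = p k s'" if s': "s' \<in> ?I" for s'
  proof (rule integral_curve_unique[OF M X _ _ _ s'])
    show "of_int k * \<epsilon> \<in> ?I"
      using \<open>\<epsilon> > 0\<close> by (simp add: algebra_simps)
    show "integral_curve_at M X (p (k - 1)) s'" "integral_curve_at M X (p k) s'" if "s' \<in> ?I" for s'
      using that \<open>\<epsilon> > 0\<close> by (auto intro!: pieces simp: algebra_simps abs_less_iff)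
  qed (use meet in auto)
  have "p k s' = p \<lfloor>s' / \<epsilon>\<rfloor> s'" if s': "s' \<in> ?I" for s'
  proof (cases "s' < of_int k * \<epsilon>")
    case True
    then have "\<lfloor>s' / \<epsilon>\<rfloor> = k - 1"
      using s' \<open>\<epsilon> > 0\<close> by (intro floor_unique) (auto simp: field_simps)
    then show ?thesis
      using overlap[OF s'] by simp
  next
    case False
    then have "\<lfloor>s' / \<epsilon>\<rfloor> = k"
      using s' \<open>\<epsilon> > 0\<close> by (intro floor_unique) (auto simp: field_simps)
    then show ?thesis by simp
  qed
  moreover have "s \<in> ?I"
    using k_bounds \<open>\<epsilon> > 0\<close> by (auto simp: algebra_simps)
  ultimately have near: "\<forall>\<^sub>F s' in nhds s. p k s' = p \<lfloor>s' / \<epsilon>\<rfloor> s'"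
    by (intro eventually_mono[OF eventually_nhds_in_open[OF open_greaterThanLessThan]])
  have "integral_curve_at M X (p k) s"
    using k_bounds \<open>\<epsilon> > 0\<close> by (intro pieces) (auto simp: algebra_simps abs_less_iff)
  from integral_curve_at_transform[OF this near] show ?thesis .
qed


section \<open>The exponential map of a Lie group\<close>

locale lie_group_manifold =
  fixes G :: "'g monoid" (structure) and M :: "('g, 'e::euclidean_space) mfd"
  assumes lie: "lie_group G M"

sublocale lie_group_manifold \<subseteq> group G
  using lie by (simp add: lie_group_def)

context lie_group_manifold
begin

lemma points: "points M = carrier G"
  using lie by (simp add: lie_group_def)

lemma Hausdorff: "Hausdorff_space (mfd_top M)"
  using lie by (simp add: lie_group_def smooth_manifold_def)

lemma manifold: "differentiable_manifold M"
  using lie by (simp add: lie_group_def smooth_manifold_imp_differentiable_manifold)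

lemma smooth_mult: "smooth_map (prod_mfd M M) M (\<lambda>(g, h). g \<otimes> h)"
  using lie by (simp add: lie_group_def)

lemma chart_at_one: "chart_at M \<one> \<in> charts_at M \<one>"
  by (rule chart_at_in_charts_at[OF manifold]) (simp add: points)

lemma mult_differentiable:
  assumes "g \<in> carrier G" "h \<in> carrier G"
  shows "differentiable_map_at (prod_mfd M M) M (\<lambda>(g, h). g \<otimes> h) (g, h)"
  by (rule Cr_map_imp_differentiable_map_at[OF differentiable_manifold_prod[OF manifold manifold]
        manifold smooth_mult]) (use assms in \<open>auto simp: points_prod points\<close>)

lemma left_mult_differentiable:
  "g \<in> carrier G \<Longrightarrow> h \<in> carrier G \<Longrightarrow> differentiable_map_at M M (\<lambda>x. g \<otimes> x) h"
  using differentiable_map_at_partial_snd[OF manifold manifold mult_differentiable] by simp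

abbreviation field :: "('g, 'e) tvec \<Rightarrow> 'g \<Rightarrow> ('g, 'e) tvec" where
  "field \<equiv> left_invariant_field G M"

lemma field_in_tangent_space:
  assumes "\<xi> \<in> lie_algebra G M" "g \<in> carrier G"
  shows "field \<xi> g \<in> tangent_space M g"
  using tangent_map_in_tangent_space[OF manifold manifold left_mult_differentiable[of g \<one>]] assms
  by (simp add: left_invariant_field_def lie_algebra_def)

lemma field_left_mult:
  assumes \<xi>: "\<xi> \<in> lie_algebra G M" and g: "g \<in> carrier G" and h: "h \<in> carrier G"
  shows "field \<xi> (g \<otimes> h) = tangent_map M M (\<lambda>x. g \<otimes> x) h (field \<xi> h)"
proof -
  have \<xi>: "\<xi> \<in> tangent_space M \<one>"
    using \<xi> by (simp add: lie_algebra_def)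
  have h_diff: "differentiable_map_at M M (\<lambda>x. h \<otimes> x) \<one>"
    and g_diff: "differentiable_map_at M M (\<lambda>x. g \<otimes> x) (h \<otimes> \<one>)"
    using g h by (simp_all add: left_mult_differentiable)
  have "field \<xi> (g \<otimes> h) = tangent_map M M (\<lambda>x. g \<otimes> (h \<otimes> x)) \<one> \<xi>"
    unfolding left_invariant_field_def
    by (rule tangent_map_transform[OF manifold _ _ \<xi>])
      (use g h in \<open>auto simp: left_mult_differentiable points m_assoc\<close>)
  also have "\<dots> = tangent_map M M (\<lambda>x. g \<otimes> x) h (field \<xi> h)"
    using tangent_map_compose[OF manifold manifold h_diff g_diff \<xi>] h
    by (simp add: left_invariant_field_def)
  finally show ?thesis .
qed

lemma field_tscale:
  assumes "\<xi> \<in> lie_algebra G M" "g \<in> carrier G"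
  shows "field (tscale a \<xi>) g = tscale a (field \<xi> g)"
  using assms tangent_map_tscale[OF manifold left_mult_differentiable]
  by (simp add: left_invariant_field_def lie_algebra_def)

lemma tscale_in_lie_algebra: "\<xi> \<in> lie_algebra G M \<Longrightarrow> tscale a \<xi> \<in> lie_algebra G M"
  using tscale_in_tangent_space[OF manifold] by (simp add: lie_algebra_def)

lemma field_chart:
  fixes e defines "e \<equiv> chart_at M \<one>"
  assumes \<xi>: "\<xi> \<in> lie_algebra G M" and d_at: "d \<in> charts_at M g"
  shows "field \<xi> g d =
    frechet_derivative (coord d \<circ> (\<lambda>(g, h). g \<otimes> h) \<circ> param (prod_chart d e))
      (at (coord d g, coord e \<one>)) (0, \<xi> e)"
proof -
  have g: "g \<in> carrier G"
    using charts_atD(3)[OF manifold d_at] by (simp add: points)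
  have e_at: "e \<in> charts_at M \<one>"
    unfolding e_def by (rule chart_at_one)
  have de_at: "prod_chart d e \<in> charts_at (prod_mfd M M) (g, \<one>)"
    using d_at e_at by (intro prod_chart_in_charts_at) simp_all
  obtain B where B_deriv: "has_chart_derivative (prod_chart d e) d (\<lambda>(g, h). g \<otimes> h) (g, \<one>) B"
    using differentiable_map_atE[OF mult_differentiable[OF g one_closed] de_at, of d] d_at g by auto
  from has_chart_derivative_partial_snd
    [OF charts_atD(1,2)[OF manifold d_at] charts_atD(1,2)[OF manifold e_at] B_deriv]
  have "has_chart_derivative e d (\<lambda>x. g \<otimes> x) \<one> (\<lambda>v. B (0, v))"
    by simp
  from tangent_map_chart[OF manifold \<xi>[unfolded lie_algebra_def] e_at this]
  have "field \<xi> g d = B (0, \<xi> e)"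
    using d_at g by (simp add: left_invariant_field_def)
  then show ?thesis
    using has_chart_derivative_frechet[OF B_deriv] by simp
qed

lemma field_locally_lipschitz:
  assumes \<xi>: "\<xi> \<in> lie_algebra G M"
  shows "locally_lipschitz_field M (field \<xi>)"
  unfolding locally_lipschitz_field_def
proof (intro conjI ballI)
  show "field \<xi> q \<in> tangent_space M q" if "q \<in> points M" for q
    using field_in_tangent_space[OF \<xi>] that by (simp add: points)
next
  fix d assume d_atlas: "d \<in> atlas M"
  let ?e = "chart_at M \<one>" and ?m = "\<lambda>(g, h). g \<otimes> h"
  let ?C = "prod_chart d ?e"
  let ?S = "coord ?C ` (dom_of ?C \<inter> ?m -` dom_of d)"
  have d_at: "d \<in> charts_at M g \<and> g \<in> carrier G \<and> param d (coord d g) = g" if "g \<in> dom_of d" for g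
  proof -
    have "d \<in> charts_at M g"
      using d_atlas that by (simp add: charts_at_def)
    then show ?thesis
      using charts_atD[OF manifold] param_coord by (metis points)
  qed
  have "coord d ` dom_of d \<subseteq> {y. (y, coord ?e \<one>) \<in> ?S}"
  proof safe
    fix g assume g: "g \<in> dom_of d"
    then have "(g, \<one>) \<in> dom_of ?C \<inter> ?m -` dom_of d"
      using d_at charts_atD(2)[OF manifold chart_at_one] by simp
    then have "coord ?C (g, \<one>) \<in> ?S"
      by (rule imageI)
    then show "(coord d g, coord ?e \<one>) \<in> ?S"
      by simp
  qed
  then have "local_lipschitz (UNIV :: real set) (coord d ` dom_of d)
      (\<lambda>_ y. frechet_derivative (coord d \<circ> ?m \<circ> param ?C) (at (y, coord ?e \<one>)) (0, \<xi> ?e))"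
    by (intro local_lipschitz_subset[OF Cr_map_partial_derivative_local_lipschitz
          [OF manifold manifold manifold smooth_mult _ d_atlas _ d_atlas]])
      (use chart_at_one in \<open>auto simp: charts_at_def\<close>)
  then show "local_lipschitz (UNIV :: real set) (coord d ` dom_of d) (\<lambda>_ y. field \<xi> (param d y) d)"
  proof (rule local_lipschitz_transform)
    fix y assume "y \<in> coord d ` dom_of d"
    then obtain g where "g \<in> dom_of d" "y = coord d g"
      by blast
    then show "frechet_derivative (coord d \<circ> ?m \<circ> param ?C) (at (y, coord ?e \<one>)) (0, \<xi> ?e) =
        field \<xi> (param d y) d"
      using field_chart[OF \<xi>, of d g] d_at by simp
  qed
qed

lemma integral_curve_at_left_mult:
  assumes \<xi>: "\<xi> \<in> lie_algebra G M" and g: "g \<in> carrier G" and \<gamma>: "integral_curve_at M (field \<xi>) \<gamma> s"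
  shows "integral_curve_at M (field \<xi>) (\<lambda>s. g \<otimes> \<gamma> s) s"
proof -
  have h: "\<gamma> s \<in> carrier G"
    using integral_curve_at_in_points[OF \<gamma>] by (simp add: points)
  from has_velocity_compose[OF manifold manifold \<gamma>[unfolded integral_curve_at_def]
      left_mult_differentiable[OF g h]]
  show ?thesis
    by (simp add: integral_curve_at_def field_left_mult[OF \<xi> g h])
qed

text \<open>A local integral curve \<open>\<sigma>\<close> through the identity is continued by left translation: near
  \<open>k * \<epsilon>\<close> the global curve is \<open>\<sigma> \<epsilon> [^] k \<otimes> \<sigma> (s - k * \<epsilon>)\<close>.\<close>

lemma field_global_integral_curve:
  assumes \<xi>: "\<xi> \<in> lie_algebra G M"
  obtains \<gamma> where "\<gamma> 0 = \<one>" "\<forall>s. integral_curve_at M (field \<xi>) \<gamma> s"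
proof -
  note X = field_locally_lipschitz[OF \<xi>]
  obtain \<delta> \<sigma> where "\<delta> > 0" and \<sigma>_0: "\<sigma> 0 = \<one>"
    and \<sigma>: "\<forall>s. \<bar>s\<bar> < \<delta> \<longrightarrow> integral_curve_at M (field \<xi>) \<sigma> s"
    using integral_curve_local_existence[OF manifold X, of \<one>] by (auto simp: points)
  define \<epsilon> where "\<epsilon> = \<delta> / 2"
  have \<epsilon>: "\<epsilon> > 0" "2 * \<epsilon> = \<delta>"
    using \<open>\<delta> > 0\<close> by (simp_all add: \<epsilon>_def)
  have "integral_curve_at M (field \<xi>) \<sigma> \<epsilon>"
    using \<sigma> \<epsilon> by simp
  then have step_in: "\<sigma> \<epsilon> \<in> carrier G"
    using integral_curve_at_in_points points by blast
  define p where "p k s = \<sigma> \<epsilon> [^] k \<otimes> \<sigma> (s - of_int k * \<epsilon>)" for k :: int and s :: real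
  have pieces: "integral_curve_at M (field \<xi>) (p k) s" if "\<bar>s - of_int k * \<epsilon>\<bar> < 2 * \<epsilon>" for k s
    unfolding p_def by (intro integral_curve_at_left_mult[OF \<xi>] integral_curve_at_shift)
      (use \<sigma> \<epsilon> step_in that in simp_all)
  have meet: "p (k - 1) (of_int k * \<epsilon>) = p k (of_int k * \<epsilon>)" for k
  proof -
    have "\<sigma> \<epsilon> [^] k = \<sigma> \<epsilon> [^] (k - 1) \<otimes> \<sigma> \<epsilon>"
      using int_pow_mult[OF step_in, of "k - 1" 1] step_in by simp
    then show ?thesis
      using step_in by (simp add: p_def \<sigma>_0 algebra_simps)
  qed
  show ?thesis
  proof (rule that)
    show "p \<lfloor>0 / \<epsilon>\<rfloor> 0 = \<one>"
      by (simp add: p_def \<sigma>_0)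
    show "\<forall>s. integral_curve_at M (field \<xi>) (\<lambda>s. p \<lfloor>s / \<epsilon>\<rfloor> s) s"
      using integral_curve_at_glue[OF manifold Hausdorff X \<epsilon>(1) pieces meet] by blast
  qed
qed

lemma lie_exp_eqI:
  assumes \<xi>: "\<xi> \<in> lie_algebra G M" and \<gamma>: "\<gamma> 0 = \<one>" "\<forall>s. integral_curve_at M (field \<xi>) \<gamma> s"
  shows "lie_exp G M \<xi> = \<gamma> 1"
proof -
  have "(THE \<gamma>. integral_curve M (field \<xi>) \<gamma> \<and> \<gamma> 0 = \<one>) = \<gamma>"
  proof (rule the_equality)
    show "integral_curve M (field \<xi>) \<gamma> \<and> \<gamma> 0 = \<one>"
      using \<gamma> by (simp add: integral_curve_iff[OF manifold])
    fix \<delta> assume \<delta>: "integral_curve M (field \<xi>) \<delta> \<and> \<delta> 0 = \<one>"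
    have "\<delta> s = \<gamma> s" for s
      by (rule integral_curve_unique[OF manifold Hausdorff field_locally_lipschitz[OF \<xi>]
            open_UNIV connected_UNIV, of 0])
        (use \<gamma> \<delta> in \<open>simp_all add: integral_curve_iff[OF manifold]\<close>)
    then show "\<delta> = \<gamma>" ..
  qed
  then show ?thesis
    by (simp add: lie_exp_def)
qed

lemma lie_exp_one_parameter:
  assumes \<xi>: "\<xi> \<in> lie_algebra G M"
  shows "lie_exp G M (tscale 0 \<xi>) = \<one>"
    and "integral_curve_at M (field \<xi>) (\<lambda>s. lie_exp G M (tscale s \<xi>)) s"
proof -
  obtain \<gamma> where \<gamma>: "\<gamma> 0 = \<one>" "\<forall>s. integral_curve_at M (field \<xi>) \<gamma> s"
    using field_global_integral_curve[OF \<xi>] .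
  have "lie_exp G M (tscale s \<xi>) = \<gamma> s" for s
  proof -
    have "integral_curve_at M (field (tscale s \<xi>)) (\<lambda>\<tau>. \<gamma> (s * \<tau>)) \<tau>" for \<tau>
    proof (rule integral_curve_at_rescale)
      show "integral_curve_at M (field \<xi>) \<gamma> (s * \<tau>)"
        using \<gamma>(2) by simp
      then have "\<gamma> (s * \<tau>) \<in> carrier G"
        using integral_curve_at_in_points points by blast
      then show "field (tscale s \<xi>) (\<gamma> (s * \<tau>)) = tscale s (field \<xi> (\<gamma> (s * \<tau>)))"
        by (rule field_tscale[OF \<xi>])
    qed
    then show ?thesis
      using lie_exp_eqI[OF tscale_in_lie_algebra[OF \<xi>], of "\<lambda>\<tau>. \<gamma> (s * \<tau>)" s] \<gamma>(1) by simp
  qed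
  with \<gamma> show "lie_exp G M (tscale 0 \<xi>) = \<one>"
    and "integral_curve_at M (field \<xi>) (\<lambda>s. lie_exp G M (tscale s \<xi>)) s"
    by simp_all
qed

end


section \<open>Discrete momentum maps\<close>

lemma differential_eq_theta:
  assumes Q: "differentiable_manifold Q"
    and f: "Cr_map r (prod_mfd Q Q) euclidean_mfd (\<lambda>(x, y). f x y)" "1 \<le> r"
    and x: "x \<in> points Q" and y: "y \<in> points Q" and w: "w \<in> tangent_space (prod_mfd Q Q) (x, y)"
  shows "differential (prod_mfd Q Q) (\<lambda>(x, y). f x y) (x, y) w =
    theta_plus Q f x y w + theta_minus Q f x y w"
proof -
  have "differentiable_map_at (prod_mfd Q Q) euclidean_mfd (\<lambda>(x, y). f x y) (x, y)"
    by (rule Cr_map_imp_differentiable_map_at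
        [OF differentiable_manifold_prod[OF Q Q] differentiable_manifold_euclidean f])
      (simp add: points_prod x y)
  from tangent_map_prod_split[OF Q Q this w, of id_chart] show ?thesis
    by (simp add: theta_plus_def theta_minus_def D_fst_def D_snd_def differential_eq_tangent_map
        charts_at_euclidean)
qed

locale lie_group_action = lie_group_manifold G M
  for G :: "'g monoid" (structure) and M :: "('g, 'd::euclidean_space) mfd" +
  fixes Q :: "('q, 'e::euclidean_space) mfd" and \<Phi> :: "'g \<Rightarrow> 'q \<Rightarrow> 'q"
  assumes smooth_Q: "smooth_manifold Q" and action: "smooth_left_action G M Q \<Phi>"
begin

lemmas Q = smooth_manifold_imp_differentiable_manifold[OF smooth_Q]

abbreviation generator :: "('g, 'd) tvec \<Rightarrow> 'q \<Rightarrow> ('q, 'e) tvec" where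
  "generator \<equiv> infinitesimal_generator G M Q \<Phi>"

abbreviation pair_generator :: "('g, 'd) tvec \<Rightarrow> 'q \<Rightarrow> 'q \<Rightarrow> ('q \<times> 'q, 'e \<times> 'e) tvec" where
  "pair_generator \<equiv> diagonal_generator G M Q \<Phi>"

lemma action_one: "x \<in> points Q \<Longrightarrow> \<Phi> \<one> x = x"
  using action group_action.id_eq_one[of G "points Q" \<Phi>]
  unfolding smooth_left_action_def by (metis restrict_apply')

lemma orbit_map_differentiable:
  assumes "g \<in> carrier G" "x \<in> points Q"
  shows "differentiable_map_at M Q (\<lambda>g. \<Phi> g x) g"
proof -
  have "differentiable_map_at (prod_mfd M Q) Q (\<lambda>(g, x). \<Phi> g x) (g, x)"
    using action assms unfolding smooth_left_action_def
    by (intro Cr_map_imp_differentiable_map_at[where r=\<infinity>] differentiable_manifold_prod manifold Q)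
      (auto simp: points_prod points)
  from differentiable_map_at_partial_fst[OF manifold Q this] show ?thesis
    by simp
qed

lemma exp_orbit_has_velocity:
  assumes \<xi>: "\<xi> \<in> lie_algebra G M" and N: "differentiable_manifold N"
    and f: "differentiable_map_at M N f \<one>"
  shows "has_velocity N (\<lambda>s. f (lie_exp G M (tscale s \<xi>))) 0
    (velocity N (\<lambda>s. f (lie_exp G M (tscale s \<xi>))) 0)"
proof -
  note one_parameter = lie_exp_one_parameter(2)[OF \<xi>, of 0, unfolded integral_curve_at_def]
  have "differentiable_map_at M N f (lie_exp G M (tscale 0 \<xi>))"
    using f by (simp add: lie_exp_one_parameter(1)[OF \<xi>])
  from has_velocity_compose[OF manifold N one_parameter this] show ?thesis
    using has_velocity_imp_velocity by metis
qed

lemma generator_has_velocity: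
  assumes "\<xi> \<in> lie_algebra G M" "x \<in> points Q"
  shows "has_velocity Q (\<lambda>s. \<Phi> (lie_exp G M (tscale s \<xi>)) x) 0 (generator \<xi> x)"
  unfolding infinitesimal_generator_def
  by (rule exp_orbit_has_velocity[OF assms(1) Q]) (simp add: orbit_map_differentiable assms(2))

lemma generator_in_tangent_space:
  assumes \<xi>: "\<xi> \<in> lie_algebra G M" and x: "x \<in> points Q"
  shows "generator \<xi> x \<in> tangent_space Q x"
  using has_velocity_in_tangent_space[OF Q generator_has_velocity[OF \<xi> x]]
  by (simp add: lie_exp_one_parameter(1)[OF \<xi>] action_one[OF x])

lemma pair_generator_has_velocity:
  assumes \<xi>: "\<xi> \<in> lie_algebra G M" and "x \<in> points Q" "y \<in> points Q"
  shows "has_velocity (prod_mfd Q Q)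
    (\<lambda>s. (\<Phi> (lie_exp G M (tscale s \<xi>)) x, \<Phi> (lie_exp G M (tscale s \<xi>)) y)) 0 (pair_generator \<xi> x y)"
  using assms
    exp_orbit_has_velocity[OF \<xi> differentiable_manifold_prod[OF Q Q], of "\<lambda>g. (\<Phi> g x, \<Phi> g y)"]
  by (simp add: diagonal_generator_def infinitesimal_generator_def diagonal_action_def
      differentiable_map_at_Pair orbit_map_differentiable)

lemma pair_generator_in_tangent_space:
  assumes \<xi>: "\<xi> \<in> lie_algebra G M" and x: "x \<in> points Q" and y: "y \<in> points Q"
  shows "pair_generator \<xi> x y \<in> tangent_space (prod_mfd Q Q) (x, y)"
  using has_velocity_in_tangent_space[OF differentiable_manifold_prod[OF Q Q]
      pair_generator_has_velocity[OF \<xi> x y]]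
  by (simp add: lie_exp_one_parameter(1)[OF \<xi>] action_one x y)

lemma tangent_map_fst_pair_generator:
  assumes \<xi>: "\<xi> \<in> lie_algebra G M" and x: "x \<in> points Q" and y: "y \<in> points Q"
  shows "tangent_map (prod_mfd Q Q) Q fst (x, y) (pair_generator \<xi> x y) = generator \<xi> x"
proof -
  have "differentiable_map_at (prod_mfd Q Q) Q fst (x, y)"
    by (rule differentiable_map_at_fst[OF Q Q]) (simp add: points_prod x y)
  then have "has_velocity Q (\<lambda>s. \<Phi> (lie_exp G M (tscale s \<xi>)) x) 0
      (tangent_map (prod_mfd Q Q) Q fst (x, y) (pair_generator \<xi> x y))"
    using has_velocity_compose[OF differentiable_manifold_prod[OF Q Q] Q
        pair_generator_has_velocity[OF \<xi> x y], of fst]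
    by (simp add: lie_exp_one_parameter(1)[OF \<xi>] action_one x y)
  then show ?thesis
    using has_velocity_imp_velocity generator_has_velocity[OF \<xi> x] by metis
qed

lemma tangent_map_snd_pair_generator:
  assumes \<xi>: "\<xi> \<in> lie_algebra G M" and x: "x \<in> points Q" and y: "y \<in> points Q"
  shows "tangent_map (prod_mfd Q Q) Q snd (x, y) (pair_generator \<xi> x y) = generator \<xi> y"
proof -
  have "differentiable_map_at (prod_mfd Q Q) Q snd (x, y)"
    by (rule differentiable_map_at_snd[OF Q Q]) (simp add: points_prod x y)
  then have "has_velocity Q (\<lambda>s. \<Phi> (lie_exp G M (tscale s \<xi>)) y) 0
      (tangent_map (prod_mfd Q Q) Q snd (x, y) (pair_generator \<xi> x y))"
    using has_velocity_compose[OF differentiable_manifold_prod[OF Q Q] Q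
        pair_generator_has_velocity[OF \<xi> x y], of snd]
    by (simp add: lie_exp_one_parameter(1)[OF \<xi>] action_one x y)
  then show ?thesis
    using has_velocity_imp_velocity generator_has_velocity[OF \<xi> y] by metis
qed

lemma momentum_plus_eq_momentum_minus:
  assumes f: "Cr_map r (prod_mfd Q Q) euclidean_mfd (\<lambda>(x, y). f x y)" "1 \<le> r"
    and symmetric: "infinitesimally_symmetric G M Q \<Phi> f" and x: "x \<in> points Q" and y: "y \<in> points Q"
  shows "momentum_plus G M Q \<Phi> f x y = momentum_minus G M Q \<Phi> f x y"
proof -
  have "theta_plus Q f x y (pair_generator \<xi> x y) = - theta_minus Q f x y (pair_generator \<xi> x y)"
    if \<xi>: "\<xi> \<in> lie_algebra G M" for \<xi>
  proof -
    have "theta_plus Q f x y (pair_generator \<xi> x y) + theta_minus Q f x y (pair_generator \<xi> x y) =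
        differential (prod_mfd Q Q) (\<lambda>(x, y). f x y) (x, y) (pair_generator \<xi> x y)"
      by (rule differential_eq_theta
          [OF Q f x y pair_generator_in_tangent_space[OF \<xi> x y], symmetric])
    also have "\<dots> = 0"
      using symmetric \<xi> x y by (simp add: infinitesimally_symmetric_def)
    finally show ?thesis
      by simp
  qed
  then show ?thesis
    unfolding momentum_plus_def momentum_minus_def by (intro restrict_ext)
qed

lemma momentum_minus_eq_momentum_plus_prev:
  assumes q: "discrete_EL_solution Q N F q" and k: "k \<in> {1..N - 1}"
  shows "momentum_minus G M Q \<Phi> (F k) (q k) (q (k + 1)) =
           momentum_plus G M Q \<Phi> (F (k - 1)) (q (k - 1)) (q k)"
proof -
  have q_in_points: "q (k - 1) \<in> points Q" "q k \<in> points Q" "q (k + 1) \<in> points Q"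
    using q k unfolding discrete_EL_solution_def by auto
  have "- theta_minus Q (F k) (q k) (q (k + 1)) (pair_generator \<xi> (q k) (q (k + 1))) =
      theta_plus Q (F (k - 1)) (q (k - 1)) (q k) (pair_generator \<xi> (q (k - 1)) (q k))"
    if \<xi>: "\<xi> \<in> lie_algebra G M" for \<xi>
  proof -
    have "D_fst Q (F k) (q k) (q (k + 1)) (generator \<xi> (q k)) +
        D_snd Q (F (k - 1)) (q (k - 1)) (q k) (generator \<xi> (q k)) = 0"
      using q k generator_in_tangent_space[OF \<xi> q_in_points(2)]
      unfolding discrete_EL_solution_def by blast
    then show ?thesis
      unfolding theta_minus_def theta_plus_def
        tangent_map_fst_pair_generator[OF \<xi> q_in_points(2,3)]
        tangent_map_snd_pair_generator[OF \<xi> q_in_points(1,2)]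
      by (simp only: neg_eq_iff_add_eq_0)
  qed
  then show ?thesis
    unfolding momentum_plus_def momentum_minus_def by (intro restrict_ext)
qed

lemma momentum_conserved:
  assumes q: "discrete_EL_solution Q N F q"
    and momenta_eq: "\<And>k x y. x \<in> points Q \<Longrightarrow> y \<in> points Q \<Longrightarrow>
      momentum_plus G M Q \<Phi> (F k) x y = momentum_minus G M Q \<Phi> (F k) x y"
    and "k < N"
  shows "momentum_plus G M Q \<Phi> (F k) (q k) (q (k + 1)) = momentum_plus G M Q \<Phi> (F 0) (q 0) (q 1)"
  using \<open>k < N\<close>
proof (induction k)
  case (Suc k)
  have "q (Suc k) \<in> points Q" "q (Suc k + 1) \<in> points Q"
    using q Suc.prems unfolding discrete_EL_solution_def by auto
  then show ?case
    using Suc momentum_minus_eq_momentum_plus_prev[OF q, of "Suc k"] momenta_eq by simp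
qed simp

end

theorem mainTheorem4:
  fixes Q :: "('q, 'e::euclidean_space) mfd"
    and G :: "'g monoid" and GM :: "('g, 'd::euclidean_space) mfd"
    and \<Phi> :: "'g \<Rightarrow> 'q \<Rightarrow> 'q"
    and P :: "'w measure"
    and a b h :: real and N :: nat and t :: "nat \<Rightarrow> real"
    and Ld :: "'q \<Rightarrow> 'q \<Rightarrow> real"
    and B :: "real \<Rightarrow> 'q \<Rightarrow> 'q \<Rightarrow> 'w \<Rightarrow> real"
    and L :: "real \<Rightarrow> 'w \<Rightarrow> 'q \<Rightarrow> 'q \<Rightarrow> real"
    and r s :: enat
  assumes "smooth_manifold Q"
    and "prob_space P"
    and "a < b" and "N \<ge> 2"
    and "h = (b - a) / real N" and "\<And>k. t k = a + h * real k"
    and "stochastic_discrete_lagrangian P Q Ld B L"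
    and "r \<ge> 1"
    and "\<And>\<tau> \<omega>. \<omega> \<in> space P \<Longrightarrow>
           Cr_map r (prod_mfd Q Q) euclidean_mfd (\<lambda>(x, y). L \<tau> \<omega> x y)"
    and "s \<ge> 1"
    and "AE \<omega> in P. uniquely_solvable s Q N (\<lambda>k. L (t k) \<omega>)"
    and "lie_group G GM"
    and "smooth_left_action G GM Q \<Phi>"
    and "\<And>\<tau> \<omega>. \<omega> \<in> space P \<Longrightarrow> infinitesimally_symmetric G GM Q \<Phi> (L \<tau> \<omega>)"
  shows "(\<forall>\<tau>. \<forall>\<omega>\<in>space P. \<forall>x\<in>points Q. \<forall>y\<in>points Q.
            momentum_plus G GM Q \<Phi> (L \<tau> \<omega>) x y = momentum_minus G GM Q \<Phi> (L \<tau> \<omega>) x y) \<and>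
         (AE \<omega> in P. \<forall>q. discrete_EL_solution Q N (\<lambda>k. L (t k) \<omega>) q \<longrightarrow>
            momentum_plus G GM Q \<Phi> (L (t (N - 1)) \<omega>) (q (N - 1)) (q N) =
            momentum_plus G GM Q \<Phi> (L (t 0) \<omega>) (q 0) (q 1))"
proof -
  interpret lie_group_action G GM Q \<Phi>
    by unfold_locales fact+
  have momenta_eq: "momentum_plus G GM Q \<Phi> (L \<tau> \<omega>) x y = momentum_minus G GM Q \<Phi> (L \<tau> \<omega>) x y"
    if "\<omega> \<in> space P" "x \<in> points Q" "y \<in> points Q" for \<tau> \<omega> x y
    using momentum_plus_eq_momentum_minus assms(8,9,14) that by blast
  have "momentum_plus G GM Q \<Phi> (L (t (N - 1)) \<omega>) (q (N - 1)) (q N) =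
      momentum_plus G GM Q \<Phi> (L (t 0) \<omega>) (q 0) (q 1)"
    if "\<omega> \<in> space P" "discrete_EL_solution Q N (\<lambda>k. L (t k) \<omega>) q" for \<omega> q
    using momentum_conserved[OF that(2) momenta_eq[OF that(1)], of "N - 1"] \<open>N \<ge> 2\<close> by simp
  with momenta_eq show ?thesis by (simp add: AE_I2)
qed

end
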